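(* Assume there are positive constants $L_1,L_2,L_3$ such that for all $s,t\in[0,T]$ and all $x,y,x_1,x_2,y_1,y_2\in\mathbb R$: $|b(t,x,y)-b(s,x,y)|+|\sigma(t,x,y)-\sigma(s,x,y)|\le L_1|t-s|$, $|b(t,x_1,y_1)-b(t,x_2,y_2)|+|\sigma(t,x_1,y_1)-\sigma(t,x_2,y_2)|\le L_2(|x_1-x_2|+|y_1-y_2|)$, $|b(t,x,y)|+|\sigma(t,x,y)|\le L_3(1+|x|+|y|)$. Assume also that $K(t,s,x)$ is differentiable in $x$ and there are positive constants $K_1,K_2,K_3$ such that for all $t,u\in[0,T]$, $s,v\in[-r,0]$, $x,y\in\mathbb R$: $|K(t,s,x)-K(u,v,x)|\le K_1(|t-u|+|s-v|)$, $|K(t,s,x)-K(t,s,y)|\le K_2|x-y|$, $|K(t,s,x)|\le K_3(1+|x|)$. Then for any $\varepsilon>0$ and $0<\rho<H$ there exist $h_0>0$ and $\Omega_{\varepsilon,h_0,\rho}\subset\Omega$ such that $\mathbb P(\Omega_{\varepsilon,h_0,\rho})>1-\varepsilon$ and for each $\omega\in\Omega_{\varepsilon,h_0,\rho}$ there is a constant $C(\omega)>0$, not depending on $h$, such that for all $h<h_0$: $$|\tilde X^h(t)|<C(\omega)\quad\text{for all }t\in[0,T],$$ and for $0\le s<t\le T$, $$|\tilde X^h(t)-\tilde X^h(s)|\le C(\omega)(t-s)^{H-\rho}.$$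
   Context: Let $(\Omega,\mathcal F,\{\mathcal F_t\}_{t\ge0},\mathbb P)$ be a complete filtered probability space satisfying the usual conditions, $r>0$, $T=r$, $H\in(1/2,1)$, and $B^H$ a fractional Brownian motion with Hurst parameter $H$. The functions $b,\sigma:[0,T]\times\mathbb R\times\mathbb R\to\mathbb R$ and $K:[0,T]\times[-r,0]\times\mathbb R\to\mathbb R$ are continuous. The function $\phi:[-r,0]\to\mathbb R$ is $(H-\rho)$-Hölder continuous for every $0<\rho<H$, i.e. $|\phi(t)-\phi(s)|\le L|t-s|^{H-\rho}$ with a positive constant $L$. Euler scheme: for $N\in\mathbb N$ put $h=T/N$, $t_n=nh$, $n=-N,\dots,N$. Set $\tilde X^h(t)=\phi(t)$ for $t\in[-r,0]$, $\tilde Y(t)=\sum_{i=-N}^{-1}h\,K(t,t_i,\tilde X^h(t+t_i))$ for $t\in[0,T]$, and recursively for $t\in[t_n,t_{n+1}]$, $0\le n\le N-1$, $\tilde X^h(t)=\tilde X^h(t_n)+b(t_n,\tilde X^h(t_n),\tilde Y(t_n))(t-t_n)+\sigma(t_n,\tilde X^h(t_n),\tilde Y(t_n))(B^H(t)-B^H(t_n))$. The step size $h$ ranges over the values $T/N$. *)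

theory Defs
  imports "HOL-Probability.Probability"
begin

text \<open>
  Time is real-valued and only indices \<open>t \<ge> 0\<close> are meaningful. The library notion of a filtration
  quantifies over the whole index type, so it is applied to the family frozen at \<open>F 0\<close> for
  negative times.
\<close>

definition usual_conditions :: "'a measure \<Rightarrow> (real \<Rightarrow> 'a measure) \<Rightarrow> bool" where
  "usual_conditions M F \<longleftrightarrow>
     complete_measure M \<and>
     filtration (space M) (\<lambda>t. F (max 0 t)) \<and>
     (\<forall>t\<ge>0. subalgebra M (F t)) \<and>
     (\<forall>t\<ge>0. sets (F t) = (\<Inter>u\<in>{t<..}. sets (F u))) \<and>
     null_sets M \<subseteq> sets (F 0)"

text \<open>The first disjunct is the degenerate normal law, which \<^const>\<open>normal_density\<close> does not cover.\<close>

definition gaussian_rv :: "'a measure \<Rightarrow> ('a \<Rightarrow> real) \<Rightarrow> bool" where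
  "gaussian_rv M X \<longleftrightarrow> X \<in> borel_measurable M \<and>
     ((\<exists>\<mu>. AE \<omega> in M. X \<omega> = \<mu>) \<or>
      (\<exists>\<mu> \<sigma>. \<sigma> > 0 \<and> distributed M lborel X (\<lambda>x. ennreal (normal_density \<mu> \<sigma> x))))"

definition gaussian_process_on :: "'i set \<Rightarrow> 'a measure \<Rightarrow> ('i \<Rightarrow> 'a \<Rightarrow> real) \<Rightarrow> bool" where
  "gaussian_process_on I M X \<longleftrightarrow>
     (\<forall>J c. finite J \<longrightarrow> J \<subseteq> I \<longrightarrow> gaussian_rv M (\<lambda>\<omega>. \<Sum>j\<in>J. c j * X j \<omega>))"

text \<open>
  As usual, path continuity is part of the definition. It is only required almost surely;
  \<open>B 0 = 0\<close> almost surely follows from the covariance.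
\<close>

definition fractional_brownian_motion ::
    "'a measure \<Rightarrow> real \<Rightarrow> (real \<Rightarrow> 'a \<Rightarrow> real) \<Rightarrow> bool" where
  "fractional_brownian_motion M H B \<longleftrightarrow>
     gaussian_process_on {0..} M B \<and>
     (\<forall>t\<ge>0. (\<integral>\<omega>. B t \<omega> \<partial>M) = 0) \<and>
     (\<forall>s\<ge>0. \<forall>t\<ge>0. (\<integral>\<omega>. B s \<omega> * B t \<omega> \<partial>M) =
        (s powr (2 * H) + t powr (2 * H) - \<bar>t - s\<bar> powr (2 * H)) / 2) \<and>
     (AE \<omega> in M. continuous_on {0..} (\<lambda>t. B t \<omega>))"

definition euler_Y ::
    "(real \<Rightarrow> real \<Rightarrow> real \<Rightarrow> real) \<Rightarrow> real \<Rightarrow> nat \<Rightarrow> (real \<Rightarrow> real) \<Rightarrow> real \<Rightarrow> real" where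
  "euler_Y K T N X t =
     (let h = T / real N
      in \<Sum>i\<in>{- int N..-1}. h * K t (of_int i * h) (X (t + of_int i * h)))"

text \<open>
  For a single noise path \<open>w\<close>, \<open>euler_upto \<dots> n\<close> is the Euler path computed up to time
  \<open>t\<^sub>n = n * T / N\<close>; its values to the right of \<open>t\<^sub>n\<close> carry no meaning. The sum in \<^const>\<open>euler_Y\<close> at
  time \<open>t\<^sub>n\<close> reads the path only at times \<open>\<le> t\<^sub>n - T / N\<close>. The lemmas \<open>euler_initial\<close> and
  \<open>euler_step\<close> below are the usual defining equations of the completed path.
\<close>

primrec euler_upto ::
    "(real \<Rightarrow> real \<Rightarrow> real \<Rightarrow> real) \<Rightarrow> (real \<Rightarrow> real \<Rightarrow> real \<Rightarrow> real) \<Rightarrow> (real \<Rightarrow> real \<Rightarrow> real \<Rightarrow> real) \<Rightarrow>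
     (real \<Rightarrow> real) \<Rightarrow> real \<Rightarrow> nat \<Rightarrow> (real \<Rightarrow> real) \<Rightarrow> nat \<Rightarrow> real \<Rightarrow> real" where
  "euler_upto b \<sigma> K \<phi> T N w 0 = \<phi>"
| "euler_upto b \<sigma> K \<phi> T N w (Suc n) =
     (let X = euler_upto b \<sigma> K \<phi> T N w n; tn = real n * (T / real N)
      in (\<lambda>t. if t \<le> tn then X t
              else X tn + b tn (X tn) (euler_Y K T N X tn) * (t - tn)
                        + \<sigma> tn (X tn) (euler_Y K T N X tn) * (w t - w tn)))"

definition euler_path ::
    "(real \<Rightarrow> real \<Rightarrow> real \<Rightarrow> real) \<Rightarrow> (real \<Rightarrow> real \<Rightarrow> real \<Rightarrow> real) \<Rightarrow> (real \<Rightarrow> real \<Rightarrow> real \<Rightarrow> real) \<Rightarrow>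
     (real \<Rightarrow> real) \<Rightarrow> real \<Rightarrow> nat \<Rightarrow> (real \<Rightarrow> real) \<Rightarrow> real \<Rightarrow> real" where
  "euler_path b \<sigma> K \<phi> T N w = euler_upto b \<sigma> K \<phi> T N w N"

lemma euler_upto_stable:
  assumes "T > 0" "m \<le> n" "t \<le> real m * (T / real N)"
  shows "euler_upto b \<sigma> K \<phi> T N w n t = euler_upto b \<sigma> K \<phi> T N w m t"
  using assms(2)
proof (induction n rule: dec_induct)
  case base
  then show ?case by simp
next
  case (step n)
  have "real m * (T / real N) \<le> real n * (T / real N)"
    using step.hyps assms(1) by (intro mult_right_mono) auto
  then show ?case
    using step.IH assms(3) by (simp add: Let_def)
qed

lemma euler_initial:
  assumes "T > 0" "t \<le> 0"
  shows "euler_path b \<sigma> K \<phi> T N w t = \<phi> t"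
  using euler_upto_stable[OF assms(1), of 0 N t N] assms(2) by (simp add: euler_path_def)

lemma euler_step:
  fixes n N :: nat and T t :: real and b \<sigma> K :: "real \<Rightarrow> real \<Rightarrow> real \<Rightarrow> real" and \<phi> w :: "real \<Rightarrow> real"
  defines "tn \<equiv> real n * (T / real N)"
  assumes "T > 0" "n < N" "tn \<le> t" "t \<le> real (Suc n) * (T / real N)"
  defines "X \<equiv> euler_path b \<sigma> K \<phi> T N w"
  shows "X t = X tn + b tn (X tn) (euler_Y K T N X tn) * (t - tn)
                    + \<sigma> tn (X tn) (euler_Y K T N X tn) * (w t - w tn)"
proof -
  define Z where "Z = euler_upto b \<sigma> K \<phi> T N w n"
  have XZ: "X s = Z s" if "s \<le> tn" for s
    using euler_upto_stable[of T n N s N] assms that by (simp add: Z_def euler_path_def)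
  have "euler_Y K T N X tn = euler_Y K T N Z tn"
    unfolding euler_Y_def Let_def
    using \<open>T > 0\<close> by (intro sum.cong refl arg_cong2[of _ _ _ _ "(*)"] arg_cong[of _ _ "K _ _"] XZ)
      (auto simp: mult_nonpos_nonneg divide_nonpos_nonneg)
  moreover have "X t = euler_upto b \<sigma> K \<phi> T N w (Suc n) t"
    unfolding X_def euler_path_def
    using euler_upto_stable[of T "Suc n" N t N] assms by simp
  ultimately show ?thesis
    using XZ[of tn] XZ[of t] \<open>tn \<le> t\<close> by (auto simp: Let_def Z_def tn_def)
qed

end

theory Submission
  imports Defs
begin

text \<open>
  The exponent of the conclusion may be increased: on a bounded interval a Hoelder estimate with
  exponent \<open>\<beta>\<close> implies one with any smaller exponent, so it suffices to work with some
  \<open>\<beta>\<close> strictly between \<open>1 / 2\<close> and \<open>H\<close>. The randomness is then used only once. The increments of \<open>B\<close>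
  are centred Gaussian with variance \<open>\<bar>t - s\<bar> powr (2 * H)\<close>, hence have moments of order \<open>2 * k\<close> bounded by
  a multiple of \<open>\<bar>t - s\<bar> powr (2 * k * H)\<close>, and the chaining argument of Kolmogorov gives an event of
  probability greater than \<open>1 - \<epsilon>\<close> on which all paths are \<open>\<beta>\<close>-Hoelder with one deterministic constant
  \<open>G\<close> (\<open>fbm_holder_event\<close>). Everything else is an estimate for a single driving path, in which
  \<open>\<beta> > 1 / 2\<close> makes the theory of Young integration available on the grid.

  On the grid, compare an increment of the scheme with its one-step prediction from the left end point,
  \<open>f m * (t\<^sub>n - t\<^sub>m) + g m * (w\<^sub>n - w\<^sub>m)\<close>, where \<open>f\<close> and \<open>g\<close> are the values of the coefficients along the
  scheme. The remainder vanishes on single steps and its failure to be additive is of order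
  \<open>(t\<^sub>n - t\<^sub>m) powr (2 * \<beta>)\<close>. As \<open>2 * \<beta> > 1\<close>, repeated halving (\<open>discrete_sewing\<close>) bounds the remainder
  by the same order, with a constant that does not see the mesh. The Lipschitz condition
  on the coefficients and on the kernel \<open>K\<close> makes this constant affine in the Hoelder constant of the scheme
  up to the current time; the delay term enters only through that constant, since it averages
  time shifts of the scheme.

  On a window of length \<open>\<tau>\<close> the remainder contributes an extra factor \<open>\<tau> powr \<beta>\<close>. When \<open>\<tau>\<close> is small,
  depending on \<open>G\<close> and the coefficients only, the unknown Hoelder constant on the window can be absorbed, and
  crossing the window turns a Hoelder constant \<open>P\<close> into \<open>P'\<close> with \<open>1 + P' \<le> \<Lambda> * (1 + P)\<close>
  (\<open>window_bound\<close>). Meshes finer than \<open>h0 = \<tau>\<close> need at most \<open>\<lceil>2 * T / \<tau>\<rceil>\<close> windows, which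
  gives a bound uniform in the mesh (\<open>global_bound\<close>). Between grid points the
  scheme is an explicit function of the driving path, so the estimate extends to all times (\<open>euler_holder\<close>).
\<close>

section \<open>Hoelder continuity from dyadic increments\<close>

lemma dyadic_floor_refine:
  fixes t :: real and m :: nat
  assumes "0 \<le> t"
  defines "d \<equiv> \<lambda>n::nat. nat \<lfloor>2 ^ n * t\<rfloor>"
  shows "d (Suc m) = 2 * d m \<or> d (Suc m) = Suc (2 * d m)"
proof -
  have "\<lfloor>2 * (2 ^ m * t)\<rfloor> = 2 * \<lfloor>2 ^ m * t\<rfloor> \<or> \<lfloor>2 * (2 ^ m * t)\<rfloor> = 2 * \<lfloor>2 ^ m * t\<rfloor> + 1"
    by linarith
  moreover have "0 \<le> \<lfloor>2 ^ m * t\<rfloor>"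
    using assms by simp
  ultimately show ?thesis
    unfolding d_def by (auto simp: nat_mult_distrib nat_add_distrib mult.assoc)
qed

lemma dyadic_floor_tendsto:
  fixes t :: real
  assumes "0 \<le> t"
  shows "(\<lambda>n. real (nat \<lfloor>2 ^ n * t\<rfloor>) / 2 ^ n) \<longlonglongrightarrow> t"
proof (rule tendsto_sandwich)
  have "t - (1 / 2) ^ n \<le> real (nat \<lfloor>2 ^ n * t\<rfloor>) / 2 ^ n" for n :: nat
  proof -
    have "2 ^ n * t - 1 \<le> real (nat \<lfloor>2 ^ n * t\<rfloor>)"
      using assms by simp
    from divide_right_mono[OF this, of "2 ^ n"] show ?thesis
      by (simp add: diff_divide_distrib power_divide)
  qed
  then show "\<forall>\<^sub>F n in sequentially. t - (1 / 2) ^ n \<le> real (nat \<lfloor>2 ^ n * t\<rfloor>) / 2 ^ n"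
    by simp
  show "\<forall>\<^sub>F n in sequentially. real (nat \<lfloor>2 ^ n * t\<rfloor>) / 2 ^ n \<le> t"
    using assms by (simp add: field_simps)
  show "(\<lambda>n. t - (1 / 2) ^ n) \<longlonglongrightarrow> t"
    by (auto intro!: tendsto_eq_intros LIMSEQ_power_zero)
qed simp

text \<open>
  Walk from the level-\<open>m\<close> dyadic approximation of \<open>t\<close> from below to \<open>t\<close> itself: refining the level by one
  moves the approximation by at most one dyadic step, so the increments form a geometric series, and
  continuity identifies its limit.
\<close>

lemma dyadic_chain_bound:
  fixes f :: "real \<Rightarrow> real"
  assumes cont: "continuous_on {0..1} f" and q: "0 < q" "q < 1" and G: "0 \<le> G"
    and incr: "\<And>m j. j < 2 ^ m \<Longrightarrow> \<bar>f (real (Suc j) / 2 ^ m) - f (real j / 2 ^ m)\<bar> \<le> G * q ^ m"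
    and t: "t \<in> {0..1}"
  shows "\<bar>f t - f (real (nat \<lfloor>2 ^ m * t\<rfloor>) / 2 ^ m)\<bar> \<le> G * (q / (1 - q)) * q ^ m"
proof -
  define d where "d = (\<lambda>n::nat. nat \<lfloor>2 ^ n * t\<rfloor>)"
  have d_le: "d n \<le> 2 ^ n" for n
  proof -
    have "2 ^ n * t \<le> 2 ^ n"
      using t by (simp add: mult_left_le)
    then have "2 ^ n * t < 2 ^ n + 1"
      by linarith
    then have "\<lfloor>2 ^ n * t\<rfloor> \<le> 2 ^ n"
      by (simp add: floor_le_iff)
    then show ?thesis
      by (simp add: d_def nat_le_iff)
  qed
  \<comment> \<open>The bound telescopes: the factor \<open>q / (1 - q)\<close> is the one for which the step from \<open>n\<close> to \<open>Suc n\<close> is an equality.\<close>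
  have partial: "\<bar>f (real (d n) / 2 ^ n) - f (real (d m) / 2 ^ m)\<bar> \<le> G * (q / (1 - q)) * (q ^ m - q ^ n)"
    if "m \<le> n" for n
    using that
  proof (induction n rule: dec_induct)
    case base
    show ?case by simp
  next
    case (step n)
    have "\<bar>f (real (d (Suc n)) / 2 ^ Suc n) - f (real (d n) / 2 ^ n)\<bar> \<le> G * q ^ Suc n"
    proof -
      have eq: "real (d n) / 2 ^ n = real (2 * d n) / 2 ^ Suc n"
        by simp
      consider "d (Suc n) = 2 * d n" | "d (Suc n) = Suc (2 * d n)"
        using dyadic_floor_refine[of t n] t by (auto simp: d_def)
      then show ?thesis
      proof cases
        case 1
        then show ?thesis
          using G q by (simp add: eq del: power_Suc)
      next
        case 2
        then have "2 * d n < 2 ^ Suc n"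
          using d_le[of "Suc n"] by simp
        from incr[OF this] show ?thesis
          unfolding eq 2 .
      qed
    qed
    moreover have "G * (q / (1 - q)) * (q ^ m - q ^ n) + G * q ^ Suc n
        = G * (q / (1 - q)) * (q ^ m - q ^ Suc n)"
      using q by (simp add: field_simps)
    ultimately show ?case
      using step.IH by linarith
  qed
  have lim: "(\<lambda>n. f (real (d n) / 2 ^ n)) \<longlonglongrightarrow> f t"
  proof (rule continuous_on_tendsto_compose[OF cont _ t])
    show "(\<lambda>n. real (d n) / 2 ^ n) \<longlonglongrightarrow> t"
      using dyadic_floor_tendsto[of t] t by (simp add: d_def)
    have "real (d n) \<le> 2 ^ n" for n
      using d_le[of n] by (simp flip: of_nat_le_iff)
    then show "\<forall>\<^sub>F n in sequentially. real (d n) / 2 ^ n \<in> {0..1}"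
      by simp
  qed
  have "\<bar>f (real (d n) / 2 ^ n) - f (real (d m) / 2 ^ m)\<bar> \<le> G * (q / (1 - q)) * q ^ m"
    if "m \<le> n" for n
  proof -
    have "G * (q / (1 - q)) * (q ^ m - q ^ n) \<le> G * (q / (1 - q)) * q ^ m"
      using G q by (intro mult_left_mono) auto
    then show ?thesis
      using partial[OF that] by linarith
  qed
  then have "\<forall>\<^sub>F n in sequentially.
      \<bar>f (real (d n) / 2 ^ n) - f (real (d m) / 2 ^ m)\<bar> \<le> G * (q / (1 - q)) * q ^ m"
    using eventually_sequentially by blast
  then have "\<bar>f t - f (real (d m) / 2 ^ m)\<bar> \<le> G * (q / (1 - q)) * q ^ m"
    by (intro tendsto_upperbound[OF tendsto_rabs[OF tendsto_diff[OF lim tendsto_const]]]) auto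
  then show ?thesis
    by (simp add: d_def)
qed

text \<open>
  The bracket counts one dyadic step at the level comparable with \<open>\<bar>t - s\<bar>\<close> and two chains
  below that level; the factor \<open>2 powr \<beta>\<close> pays for rounding \<open>\<bar>t - s\<bar>\<close> up to a power of two.
\<close>

definition holder_dyadic_const :: "real \<Rightarrow> real" where
  "holder_dyadic_const \<beta> = 2 powr \<beta> * (1 + 2 * (2 powr -\<beta> / (1 - 2 powr -\<beta>)))"

lemma holder_dyadic_const_pos: "\<beta> > 0 \<Longrightarrow> holder_dyadic_const \<beta> > 0"
  using powr_less_one[of 2 "- \<beta>"]
  by (auto simp: holder_dyadic_const_def intro!: mult_pos_pos add_pos_nonneg divide_nonneg_nonneg)

text \<open>
  At the dyadic level \<open>m\<close> with \<open>(1 / 2) ^ Suc m < \<bar>t - s\<bar> \<le> (1 / 2) ^ m\<close> the approximations of \<open>s\<close> and \<open>t\<close> agree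
  or are neighbours, and \<open>dyadic_chain_bound\<close> controls the distance to them.
\<close>

lemma holder_of_dyadic_increments:
  fixes f :: "real \<Rightarrow> real"
  assumes cont: "continuous_on {0..1} f" and \<beta>: "0 < \<beta>" and G: "0 \<le> G"
    and incr: "\<And>m j. j < 2 ^ m \<Longrightarrow>
      \<bar>f (real (Suc j) / 2 ^ m) - f (real j / 2 ^ m)\<bar> \<le> G * (2 powr -\<beta>) ^ m"
    and st: "s \<in> {0..1}" "t \<in> {0..1}"
  shows "\<bar>f t - f s\<bar> \<le> G * holder_dyadic_const \<beta> * \<bar>t - s\<bar> powr \<beta>"
  using st
proof (induction s t rule: linorder_wlog)
  case (sym s t)
  then show ?case
    by (simp add: abs_minus_commute)
next
  case (le s t)
  define q :: real where "q = 2 powr -\<beta>"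
  have q: "0 < q" "q < 1"
    using \<beta> by (auto simp: q_def powr_less_one)
  show ?case
  proof (cases "s = t")
    case False
    with le have "s < t" by simp
    define P where "P = (\<lambda>m::nat. (1 / 2) ^ m < t - s)"
    have "\<exists>m. P m"
      using \<open>s < t\<close> real_arch_pow_inv[of "t - s" "1/2"] by (auto simp: P_def)
    define m where "m = (LEAST m. P m) - 1"
    have "\<not> P 0"
      using le by (simp add: P_def)
    then have Least: "(LEAST m. P m) = Suc m"
      using LeastI_ex[OF \<open>\<exists>m. P m\<close>] by (cases "LEAST m. P m") (auto simp: m_def)
    have lower: "(1 / 2) ^ Suc m < t - s"
      using LeastI_ex[OF \<open>\<exists>m. P m\<close>] unfolding Least by (simp add: P_def)
    have "\<not> P m"
      using not_less_Least[of m P] Least by simp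
    then have upper: "t - s \<le> (1 / 2) ^ m"
      by (simp add: P_def)
    define a where "a = nat \<lfloor>2 ^ m * s\<rfloor>"
    define c where "c = nat \<lfloor>2 ^ m * t\<rfloor>"
    have "2 ^ m * t - 2 ^ m * s \<le> 1"
      using upper by (simp add: field_simps power_divide)
    moreover have "2 ^ m * s \<le> 2 ^ m * t" "0 \<le> 2 ^ m * s" "2 ^ m * t < 2 ^ m + 1"
      using le by (auto intro: le_less_trans[of _ "2 ^ m"])
    ultimately have "\<lfloor>2 ^ m * t\<rfloor> = \<lfloor>2 ^ m * s\<rfloor> \<or> \<lfloor>2 ^ m * t\<rfloor> = \<lfloor>2 ^ m * s\<rfloor> + 1"
        "0 \<le> \<lfloor>2 ^ m * s\<rfloor>" "\<lfloor>2 ^ m * t\<rfloor> \<le> 2 ^ m"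
      by (linarith, linarith, simp add: floor_le_iff)
    then have ac: "c = a \<or> c = Suc a" "c \<le> 2 ^ m"
      by (auto simp: a_def c_def nat_add_distrib nat_le_iff)
    have mid: "\<bar>f (real c / 2 ^ m) - f (real a / 2 ^ m)\<bar> \<le> G * q ^ m"
    proof (cases "c = a")
      case True
      then show ?thesis using G q by simp
    next
      case False
      with ac have "c = Suc a" "a < 2 ^ m" by auto
      with incr[of a m] show ?thesis by (simp add: q_def)
    qed
    note chain = dyadic_chain_bound[OF cont q G incr[folded q_def], of _ m]
    have "\<bar>f t - f s\<bar> \<le> G * q ^ m + 2 * (G * (q / (1 - q)) * q ^ m)"
      using chain[of t] chain[of s] mid le unfolding a_def c_def by linarith
    also have "\<dots> = G * (1 + 2 * (q / (1 - q))) * q ^ m"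
      by (simp add: algebra_simps)
    also have "q ^ m = 2 powr \<beta> * ((1 / 2) ^ Suc m) powr \<beta>"
      by (simp add: q_def powr_power powr_powr power_divide powr_divide powr_minus_divide powr_mult
          flip: powr_realpow) (simp add: powr_powr powr_minus_divide powr_add algebra_simps)
    also have "((1 / 2) ^ Suc m) powr \<beta> \<le> (t - s) powr \<beta>"
      using lower \<beta> by (intro powr_mono2) auto
    finally have "\<bar>f t - f s\<bar> \<le> G * (1 + 2 * (q / (1 - q))) * (2 powr \<beta> * (t - s) powr \<beta>)"
      using G q by (simp add: mult_left_mono)
    then show ?thesis
      using le by (simp add: holder_dyadic_const_def q_def mult_ac)
  qed simp
qed

section \<open>A quantitative Kolmogorov criterion\<close>

text \<open>
  Kolmogorov's continuity criterion in quantitative form, for a process that already has continuous paths.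
  By Markov's inequality the probability that one of the \<open>2 ^ m\<close> dyadic increments of level \<open>m\<close> reaches
  \<open>L * 2 powr -(m * \<beta>)\<close> is at most \<open>D / L * \<theta> ^ m\<close> with \<open>\<theta> < 1\<close>; this is where \<open>p * \<beta> < \<gamma>\<close> enters.
  Summing over all levels, a large \<open>L\<close> makes the exceptional set smaller than \<open>\<epsilon>\<close> at once, so the Hoelder
  constant is the same for all remaining paths.
\<close>

lemma holder_event_of_moment_bound:
  fixes X :: "real \<Rightarrow> 'a \<Rightarrow> real" and p :: nat
  assumes "prob_space M" and T: "0 < T"
    and meas: "\<And>t. t \<in> {0..T} \<Longrightarrow> X t \<in> borel_measurable M"
    and cont: "AE \<omega> in M. continuous_on {0..T} (\<lambda>t. X t \<omega>)"
    and integrable: "\<And>s t. s \<in> {0..T} \<Longrightarrow> t \<in> {0..T} \<Longrightarrow> integrable M (\<lambda>\<omega>. \<bar>X t \<omega> - X s \<omega>\<bar> ^ p)"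
    and moment: "\<And>s t. s \<in> {0..T} \<Longrightarrow> t \<in> {0..T} \<Longrightarrow>
      (\<integral>\<omega>. \<bar>X t \<omega> - X s \<omega>\<bar> ^ p \<partial>M) \<le> C * \<bar>t - s\<bar> powr (1 + \<gamma>)"
    and p: "0 < p" and \<beta>: "0 < \<beta>" "real p * \<beta> < \<gamma>" and \<epsilon>: "0 < \<epsilon>"
  shows "\<exists>G>0. \<exists>A\<in>sets M. measure M A > 1 - \<epsilon> \<and>
    (\<forall>\<omega>\<in>A. \<forall>s\<in>{0..T}. \<forall>t\<in>{0..T}. \<bar>X t \<omega> - X s \<omega>\<bar> \<le> G * \<bar>t - s\<bar> powr \<beta>)"
proof -
  interpret prob_space M by fact
  define q :: real where "q = 2 powr -\<beta>"
  have q: "0 < q" by (simp add: q_def)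
  define \<theta> :: real where "\<theta> = 2 powr (real p * \<beta> - \<gamma>)"
  have \<theta>: "0 < \<theta>" "\<theta> < 1"
    using \<beta> by (auto simp: \<theta>_def powr_less_one)
  define D where "D = max C 0 * T powr (1 + \<gamma>)"
  have D: "0 \<le> D" by (simp add: D_def)
  define pt where "pt = (\<lambda>(m::nat) (j::nat). T * (real j / 2 ^ m))"
  have pt: "pt m j \<in> {0..T}" if "j \<le> 2 ^ m" for m j
  proof -
    have "real j \<le> 2 ^ m"
      using that by (simp flip: of_nat_le_iff)
    then show ?thesis
      using T by (simp add: pt_def mult_left_le field_simps)
  qed
  define L where "L = 1 + D / (\<epsilon> * (1 - \<theta>)) * 2"
  have L: "1 \<le> L"
    using D \<epsilon> \<theta> by (simp add: L_def)
  define I where "I = (\<lambda>m j \<omega>. \<bar>X (pt m (Suc j)) \<omega> - X (pt m j) \<omega>\<bar>)"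
  have I_meas: "I m j \<in> borel_measurable M" if "j < 2 ^ m" for m j
    unfolding I_def using pt[of j m] pt[of "Suc j" m] that
    by (intro borel_measurable_abs borel_measurable_diff meas) auto
  define bad where "bad = (\<lambda>m j. {\<omega> \<in> space M. L * q ^ m \<le> I m j \<omega>})"
  have bad_sets: "bad m j \<in> events" if "j < 2 ^ m" for m j
    unfolding bad_def using I_meas[OF that] by measurable
  have prob_bad: "prob (bad m j) \<le> D / L * (\<theta> / 2) ^ m" if "j < 2 ^ m" for m j
  proof -
    have j: "pt m j \<in> {0..T}" "pt m (Suc j) \<in> {0..T}"
      using pt[of j m] pt[of "Suc j" m] that by auto
    have "bad m j = {\<omega> \<in> space M. (L * q ^ m) ^ p \<le> I m j \<omega> ^ p}"
      using L q p by (auto simp: bad_def I_def power_mono_iff)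
    then have "prob (bad m j) \<le> (\<integral>\<omega>. I m j \<omega> ^ p \<partial>M) / (L * q ^ m) ^ p"
      using integral_Markov_inequality_measure[of M "\<lambda>\<omega>. I m j \<omega> ^ p" "{}" "(L * q ^ m) ^ p"]
        integrable[OF j] L q by (simp add: I_def)
    also have "(\<integral>\<omega>. I m j \<omega> ^ p \<partial>M) \<le> C * \<bar>pt m (Suc j) - pt m j\<bar> powr (1 + \<gamma>)"
      unfolding I_def using moment[OF j] .
    also have "\<bar>pt m (Suc j) - pt m j\<bar> = T / 2 ^ m"
      using T by (simp add: pt_def field_simps)
    also have "C * (T / 2 ^ m) powr (1 + \<gamma>) \<le> max C 0 * (T / 2 ^ m) powr (1 + \<gamma>)"
      by (intro mult_right_mono) auto
    also have "\<dots> = D * (2 ^ m) powr -(1 + \<gamma>)"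
      using T by (simp add: D_def powr_divide powr_minus_divide del: minus_add_distrib)
    also have "D * (2 ^ m) powr -(1 + \<gamma>) / (L * q ^ m) ^ p
        = D / L ^ p * ((2 ^ m) powr -(1 + \<gamma>) / q ^ (m * p))"
      by (simp add: power_mult_distrib power_mult)
    also have "(2 ^ m) powr -(1 + \<gamma>) / q ^ (m * p) = (\<theta> / 2) ^ m"
    proof -
      have "(2 ^ m) powr -(1 + \<gamma>) = 2 powr (- real m * (1 + \<gamma>))"
        by (simp add: powr_powr del: minus_add_distrib flip: powr_realpow)
      moreover have "q ^ (m * p) = 2 powr (- real m * real p * \<beta>)"
        by (simp add: q_def powr_power mult_ac)
      moreover have "(\<theta> / 2) ^ m = 2 powr (real m * (real p * \<beta> - \<gamma> - 1))"
        by (simp add: \<theta>_def powr_diff powr_power power_divide mult_ac right_diff_distrib powr_realpow)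
      ultimately show ?thesis
        by (simp add: algebra_simps flip: powr_diff)
    qed
    also have "D / L ^ p * (\<theta> / 2) ^ m \<le> D / L * (\<theta> / 2) ^ m"
      using L p D \<theta> self_le_power[of L p] by (intro mult_right_mono divide_left_mono mult_pos_pos) auto
    finally show ?thesis
      using L q by (simp add: divide_right_mono)
  qed
  define Bad where "Bad = (\<lambda>m. \<Union>j<2 ^ m. bad m j)"
  have Bad_sets: "Bad m \<in> events" for m
    unfolding Bad_def using bad_sets by auto
  have prob_Bad: "prob (Bad m) \<le> D / L * \<theta> ^ m" for m
  proof -
    have "prob (Bad m) \<le> (\<Sum>j<2 ^ m. prob (bad m j))"
      unfolding Bad_def using bad_sets by (intro finite_measure_subadditive_finite) auto
    also have "\<dots> \<le> (\<Sum>j<(2::nat) ^ m. D / L * (\<theta> / 2) ^ m)"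
      by (intro sum_mono prob_bad) auto
    also have "\<dots> = D / L * \<theta> ^ m"
      by (simp add: power_divide)
    finally show ?thesis .
  qed
  have summ: "summable (\<lambda>m. D / L * \<theta> ^ m)"
    using \<theta> by (intro summable_mult summable_geometric) auto
  then have summ': "summable (\<lambda>m. prob (Bad m))"
    by (rule summable_comparison_test'[of _ 0]) (use prob_Bad in auto)
  have "prob (\<Union>m. Bad m) \<le> (\<Sum>m. prob (Bad m))"
    using Bad_sets summ' by (intro finite_measure_subadditive_countably) auto
  also have "\<dots> \<le> (\<Sum>m. D / L * \<theta> ^ m)"
    by (intro suminf_le prob_Bad summ summ')
  also have "\<dots> = D / (1 - \<theta>) / L"
    using sums_unique[OF sums_mult[OF geometric_sums[of \<theta>], of "D / L"]] \<theta> by (simp add: mult.commute)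
  also have "\<dots> < \<epsilon>"
  proof -
    have "D / (1 - \<theta>) \<le> \<epsilon> * (D / (\<epsilon> * (1 - \<theta>)) * 2)"
      using \<epsilon> \<theta> D by (simp add: divide_right_mono)
    also have "\<dots> < \<epsilon> * L"
      using \<epsilon> by (simp add: L_def distrib_left)
    finally show ?thesis
      using L by (subst pos_divide_less_eq) (auto simp: mult.commute)
  qed
  finally have small: "prob (\<Union>m. Bad m) < \<epsilon>" .
  obtain N where N: "N \<in> null_sets M" "{\<omega> \<in> space M. \<not> continuous_on {0..T} (\<lambda>t. X t \<omega>)} \<subseteq> N"
    using AE_E[OF cont] by (metis null_setsI)
  \<comment> \<open>Almost sure continuity only provides a null set containing the discontinuous paths, so that set is removed as well.\<close>
  define A where "A = space M - ((\<Union>m. Bad m) \<union> N)"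
  have A_sets: "A \<in> events"
    using N Bad_sets by (auto simp: A_def)
  have "prob A = 1 - prob ((\<Union>m. Bad m) \<union> N)"
    unfolding A_def using N Bad_sets by (intro prob_compl) auto
  also have "prob ((\<Union>m. Bad m) \<union> N) = prob (\<Union>m. Bad m)"
    using N Bad_sets by (intro measure_Un_null_set) auto
  finally have A_prob: "prob A > 1 - \<epsilon>"
    using small by simp
  define G where "G = L * holder_dyadic_const \<beta> * T powr -\<beta>"
  have "G > 0"
    using L holder_dyadic_const_pos[OF \<beta>(1)] T by (simp add: G_def)
  have "\<bar>X t \<omega> - X s \<omega>\<bar> \<le> G * \<bar>t - s\<bar> powr \<beta>"
    if \<omega>: "\<omega> \<in> A" and st: "s \<in> {0..T}" "t \<in> {0..T}" for \<omega> s t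
  proof -
    define f where "f = (\<lambda>u. X (T * u) \<omega>)"
    have "continuous_on {0..T} (\<lambda>t. X t \<omega>)"
      using \<omega> N by (auto simp: A_def)
    then have "continuous_on {0..1} f"
      unfolding f_def
      by (rule continuous_on_compose2) (use T in \<open>auto intro!: continuous_intros simp: mult_left_le\<close>)
    moreover have "\<bar>f (real (Suc j) / 2 ^ m) - f (real j / 2 ^ m)\<bar> \<le> L * (2 powr -\<beta>) ^ m"
      if "j < 2 ^ m" for m j
    proof -
      have "\<omega> \<notin> bad m j" "\<omega> \<in> space M"
        using \<omega> that by (auto simp: A_def Bad_def)
      then show ?thesis
        by (auto simp: bad_def I_def f_def pt_def q_def)
    qed
    ultimately have "\<bar>f (t / T) - f (s / T)\<bar> \<le> L * holder_dyadic_const \<beta> * \<bar>t / T - s / T\<bar> powr \<beta>"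
      using L T st \<beta> by (intro holder_of_dyadic_increments) auto
    also have "\<bar>t / T - s / T\<bar> = \<bar>t - s\<bar> / T"
      using T by (simp flip: diff_divide_distrib)
    also have "(\<bar>t - s\<bar> / T) powr \<beta> = T powr -\<beta> * \<bar>t - s\<bar> powr \<beta>"
      using T by (simp add: powr_divide powr_minus_divide)
    finally show ?thesis
      using T by (simp add: f_def G_def mult_ac)
  qed
  with \<open>G > 0\<close> A_sets A_prob show ?thesis
    by blast
qed

section \<open>Moments and Hoelder paths of fractional Brownian motion\<close>

text \<open>
  In the degenerate case the variable is almost surely its mean \<open>0\<close>, and the formula still holds for \<open>k = 0\<close>
  since \<open>0 ^ 0 = 1\<close>.
\<close>

lemma centred_gaussian_moments:
  assumes "prob_space M" and X: "gaussian_rv M X" and mean: "(\<integral>\<omega>. X \<omega> \<partial>M) = 0"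
  shows "integrable M (\<lambda>\<omega>. X \<omega> ^ j)"
    and "(\<integral>\<omega>. X \<omega> ^ (2 * k) \<partial>M) = fact (2 * k) / (2 ^ k * fact k) * (\<integral>\<omega>. (X \<omega>)\<^sup>2 \<partial>M) ^ k"
proof -
  interpret prob_space M by fact
  have [measurable]: "X \<in> borel_measurable M"
    using X by (simp add: gaussian_rv_def)
  consider \<mu> where "AE \<omega> in M. X \<omega> = \<mu>"
    | \<mu> \<sigma> where "\<sigma> > 0" "distributed M lborel X (\<lambda>x. ennreal (normal_density \<mu> \<sigma> x))"
    using X by (auto simp: gaussian_rv_def)
  then have "integrable M (\<lambda>\<omega>. X \<omega> ^ j) \<and>
    (\<integral>\<omega>. X \<omega> ^ (2 * k) \<partial>M) = fact (2 * k) / (2 ^ k * fact k) * (\<integral>\<omega>. (X \<omega>)\<^sup>2 \<partial>M) ^ k"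
  proof cases
    case (1 \<mu>)
    have int: "(\<integral>\<omega>. X \<omega> ^ i \<partial>M) = \<mu> ^ i" for i
    proof -
      have "(\<integral>\<omega>. X \<omega> ^ i \<partial>M) = (\<integral>\<omega>. \<mu> ^ i \<partial>M)"
        using 1 by (intro integral_cong_AE) auto
      then show ?thesis by (simp add: prob_space)
    qed
    have "\<mu> = 0"
      using int[of 1] mean by simp
    have "integrable M (\<lambda>\<omega>. X \<omega> ^ j) \<longleftrightarrow> integrable M (\<lambda>\<omega>. \<mu> ^ j)"
      using 1 by (intro integrable_cong_AE) auto
    then show ?thesis
      using \<open>\<mu> = 0\<close> by (cases "k = 0") (simp_all add: int prob_space zero_power)
  next
    case (2 \<mu> \<sigma>)
    have "\<mu> = 0"
      using normal_distributed_expectation[OF 2] mean by simp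
    note D = 2(2)[unfolded \<open>\<mu> = 0\<close>]
    have "integrable M (\<lambda>\<omega>. X \<omega> ^ j)"
      using distributed_integrable[OF D, of "\<lambda>x. x ^ j"] integrable_normal_moment[OF 2(1), of 0 j]
      by simp
    moreover have even: "(\<integral>\<omega>. X \<omega> ^ (2 * i) \<partial>M) = fact (2 * i) / ((2 / \<sigma>\<^sup>2) ^ i * fact i)" for i
      using distributed_integral[OF D, of "\<lambda>x. x ^ (2 * i)"]
        integral_normal_moment_even[OF 2(1), of 0 i] by simp
    moreover have "(\<integral>\<omega>. (X \<omega>)\<^sup>2 \<partial>M) = \<sigma>\<^sup>2"
      using even[of 1] by (simp add: fact_numeral)
    ultimately show ?thesis
      by (simp add: power_divide)
  qed
  then show "integrable M (\<lambda>\<omega>. X \<omega> ^ j)"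
    and "(\<integral>\<omega>. X \<omega> ^ (2 * k) \<partial>M) = fact (2 * k) / (2 ^ k * fact k) * (\<integral>\<omega>. (X \<omega>)\<^sup>2 \<partial>M) ^ k"
    by blast+
qed

text \<open>
  The increment is a linear combination of the process, hence Gaussian, and expanding its square with the
  covariance of \<open>B\<close> leaves the variance \<open>\<bar>t - s\<bar> powr (2 * H)\<close>.
\<close>

lemma fbm_increment_moments:
  assumes "prob_space M" and B: "fractional_brownian_motion M H B" and st: "0 \<le> s" "0 \<le> t"
  shows "integrable M (\<lambda>\<omega>. (B t \<omega> - B s \<omega>) ^ j)"
    and "(\<integral>\<omega>. (B t \<omega> - B s \<omega>) ^ (2 * k) \<partial>M)
      = fact (2 * k) / (2 ^ k * fact k) * (\<bar>t - s\<bar> powr (2 * H)) ^ k"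
proof -
  interpret prob_space M by fact
  have lin: "gaussian_rv M (\<lambda>\<omega>. \<Sum>j\<in>J. c j * B j \<omega>)" if "finite J" "J \<subseteq> {0..}" for J c
    using B that by (auto simp: fractional_brownian_motion_def gaussian_process_on_def)
  have gauss: "gaussian_rv M (B u)" if "0 \<le> u" for u
    using lin[of "{u}" "\<lambda>_. 1"] that by simp
  have mean: "(\<integral>\<omega>. B u \<omega> \<partial>M) = 0" if "0 \<le> u" for u
    using B that by (simp add: fractional_brownian_motion_def)
  have cov: "(\<integral>\<omega>. B u \<omega> * B v \<omega> \<partial>M) = (u powr (2 * H) + v powr (2 * H) - \<bar>v - u\<bar> powr (2 * H)) / 2"
    if "0 \<le> u" "0 \<le> v" for u v
    using B that by (auto simp: fractional_brownian_motion_def)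
  have int1: "integrable M (B u)" and int2: "integrable M (\<lambda>\<omega>. (B u \<omega>)\<^sup>2)" if "0 \<le> u" for u
    using centred_gaussian_moments(1)[OF \<open>prob_space M\<close> gauss[OF that] mean[OF that], of 1]
      centred_gaussian_moments(1)[OF \<open>prob_space M\<close> gauss[OF that] mean[OF that], of 2] by simp_all
  have diff: "gaussian_rv M (\<lambda>\<omega>. B t \<omega> - B s \<omega>)"
  proof (cases "s = t")
    case True
    then show ?thesis
      by (auto simp: gaussian_rv_def)
  next
    case False
    then show ?thesis
      using lin[of "{s, t}" "\<lambda>u. if u = t then 1 else - 1"] st by simp
  qed
  have mean': "(\<integral>\<omega>. B t \<omega> - B s \<omega> \<partial>M) = 0"
    using int1 mean st by simp
  have [measurable]: "B u \<in> borel_measurable M" if "0 \<le> u" for u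
    using int1[OF that] by simp
  have prod: "integrable M (\<lambda>\<omega>. B s \<omega> * B t \<omega>)"
  proof (rule Bochner_Integration.integrable_bound)
    show "integrable M (\<lambda>\<omega>. (B s \<omega>)\<^sup>2 + (B t \<omega>)\<^sup>2)"
      using int2 st by simp
    have "\<bar>x * y\<bar> \<le> x\<^sup>2 + y\<^sup>2" for x y :: real
    proof -
      have "2 * (\<bar>x\<bar> * \<bar>y\<bar>) \<le> x\<^sup>2 + y\<^sup>2"
        using sum_squares_bound[of "\<bar>x\<bar>" "\<bar>y\<bar>"] by simp
      moreover have "0 \<le> \<bar>x\<bar> * \<bar>y\<bar>" by simp
      ultimately show ?thesis
        unfolding abs_mult by linarith
    qed
    then show "AE \<omega> in M. norm (B s \<omega> * B t \<omega>) \<le> norm ((B s \<omega>)\<^sup>2 + (B t \<omega>)\<^sup>2)"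
      by simp
  qed (use st in measurable)
  have "(\<integral>\<omega>. (B t \<omega> - B s \<omega>)\<^sup>2 \<partial>M) = (\<integral>\<omega>. (B t \<omega>)\<^sup>2 + (B s \<omega>)\<^sup>2 - 2 * (B s \<omega> * B t \<omega>) \<partial>M)"
    by (simp add: power2_diff mult_ac)
  also have "\<dots> = (\<integral>\<omega>. (B t \<omega>)\<^sup>2 \<partial>M) + (\<integral>\<omega>. (B s \<omega>)\<^sup>2 \<partial>M) - 2 * (\<integral>\<omega>. B s \<omega> * B t \<omega> \<partial>M)"
    using prod int2 st by simp
  also have "\<dots> = \<bar>t - s\<bar> powr (2 * H)"
    using cov[of t t] cov[of s s] cov[of s t] st by (simp add: power2_eq_square)
  finally have var: "(\<integral>\<omega>. (B t \<omega> - B s \<omega>)\<^sup>2 \<partial>M) = \<bar>t - s\<bar> powr (2 * H)" .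
  show "integrable M (\<lambda>\<omega>. (B t \<omega> - B s \<omega>) ^ j)"
    by (rule centred_gaussian_moments(1)[OF \<open>prob_space M\<close> diff mean'])
  show "(\<integral>\<omega>. (B t \<omega> - B s \<omega>) ^ (2 * k) \<partial>M)
      = fact (2 * k) / (2 ^ k * fact k) * (\<bar>t - s\<bar> powr (2 * H)) ^ k"
    using centred_gaussian_moments(2)[OF \<open>prob_space M\<close> diff mean', of k] var by simp
qed

text \<open>
  Any Hoelder exponent below \<open>H\<close> is reached by taking moments of sufficiently high order: the criterion
  with \<open>p = 2 * k\<close> and \<open>1 + \<gamma> = 2 * k * H\<close> requires \<open>2 * k * (H - \<beta>) > 1\<close>.
\<close>

lemma fbm_holder_event:
  assumes M: "prob_space M" and B: "fractional_brownian_motion M H B"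
    and \<beta>: "0 < \<beta>" "\<beta> < H" and "0 < T" "0 < \<epsilon>"
  shows "\<exists>G>0. \<exists>A\<in>sets M. measure M A > 1 - \<epsilon> \<and>
    (\<forall>\<omega>\<in>A. \<forall>s\<in>{0..T}. \<forall>t\<in>{0..T}. \<bar>B t \<omega> - B s \<omega>\<bar> \<le> G * \<bar>t - s\<bar> powr \<beta>)"
proof -
  obtain k :: nat where "1 / (2 * (H - \<beta>)) < real k"
    using reals_Archimedean2 by blast
  then have k: "1 < 2 * real k * (H - \<beta>)"
    using \<beta> by (simp add: field_simps)
  have "0 < k"
    using k by (cases k) auto
  note moments = fbm_increment_moments[OF M B]
  show ?thesis
  proof (rule holder_event_of_moment_bound[OF M \<open>0 < T\<close>, where p = "2 * k"
        and C = "fact (2 * k) / (2 ^ k * fact k)" and \<gamma> = "2 * real k * H - 1"])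
    show "B t \<in> borel_measurable M" if "t \<in> {0..T}" for t
    proof -
      have "gaussian_rv M (\<lambda>\<omega>. \<Sum>j\<in>{t}. 1 * B j \<omega>)"
        using B that unfolding fractional_brownian_motion_def gaussian_process_on_def
        by (elim conjE allE[of _ "{t}"] allE[of _ "\<lambda>_. 1"]) auto
      then show ?thesis by (simp add: gaussian_rv_def)
    qed
    show "AE \<omega> in M. continuous_on {0..T} (\<lambda>t. B t \<omega>)"
      using B unfolding fractional_brownian_motion_def
      by (auto elim!: eventually_mono intro: continuous_on_subset)
    show "integrable M (\<lambda>\<omega>. \<bar>B t \<omega> - B s \<omega>\<bar> ^ (2 * k))" if "s \<in> {0..T}" "t \<in> {0..T}" for s t
      using moments(1)[of s t "2 * k"] that by (simp add: power_even_abs)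
    show "(\<integral>\<omega>. \<bar>B t \<omega> - B s \<omega>\<bar> ^ (2 * k) \<partial>M)
        \<le> fact (2 * k) / (2 ^ k * fact k) * \<bar>t - s\<bar> powr (1 + (2 * real k * H - 1))"
      if "s \<in> {0..T}" "t \<in> {0..T}" for s t
      using moments(2)[of s t k] that \<open>0 < k\<close>
      by (cases "s = t") (auto simp: power_even_abs powr_power zero_power mult_ac)
    show "real (2 * k) * \<beta> < 2 * real k * H - 1"
      using k by (simp add: algebra_simps)
  qed (use \<open>0 < k\<close> \<beta> \<open>0 < \<epsilon>\<close> in auto)
qed

section \<open>Discrete sewing\<close>

text \<open>
  The discrete form of Young's estimate. Splitting an interval of \<open>n - m \<ge> 2\<close> steps near its midpoint leaves two parts of
  at most two thirds of its length (the worst case is three steps). Since \<open>\<theta> > 1\<close>, the \<open>\<theta>\<close>-th powers of their lengths add up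
  to at most the fraction \<open>(2 / 3) powr (\<theta> - 1) < 1\<close> of the \<open>\<theta>\<close>-th power of the whole length, so the defects
  of all generations of splittings sum to a geometric series.
\<close>

lemma discrete_sewing:
  fixes R :: "int \<Rightarrow> int \<Rightarrow> real"
  assumes \<theta>: "1 < \<theta>" and A: "0 \<le> A"
    and unit: "\<And>m. a \<le> m \<Longrightarrow> m < e \<Longrightarrow> R m (m + 1) = 0"
    and defect: "\<And>m k n. a \<le> m \<Longrightarrow> m < k \<Longrightarrow> k < n \<Longrightarrow> n \<le> e \<Longrightarrow>
      \<bar>R m n - R m k - R k n\<bar> \<le> A * of_int (n - m) powr \<theta>"
    and mn: "a \<le> m" "m < n" "n \<le> e"
  shows "\<bar>R m n\<bar> \<le> A / (1 - (2 / 3) powr (\<theta> - 1)) * of_int (n - m) powr \<theta>"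
  using mn
proof (induction "nat (n - m)" arbitrary: m n rule: less_induct)
  case less
  define q :: real where "q = (2 / 3) powr (\<theta> - 1)"
  have q: "0 < q" "q < 1"
    using \<theta> powr_less_mono2[of "\<theta> - 1" "2 / 3" 1] by (auto simp: q_def)
  show ?case
  proof (cases "n = m + 1")
    case True
    then show ?thesis
      using unit[of m] less.prems A q by (simp add: q_def)
  next
    case False
    define k where "k = m + (n - m) div 2"
    define l :: real where "l = of_int (n - m)"
    have k: "m < k" "k < n"
      using False less.prems by (auto simp: k_def)
    have "3 * (k - m) \<le> 2 * (n - m)" "3 * (n - k) \<le> 2 * (n - m)"
      using False less.prems by (auto simp: k_def)
    then have "of_int (3 * (k - m)) \<le> (of_int (2 * (n - m)) :: real)"
        "of_int (3 * (n - k)) \<le> (of_int (2 * (n - m)) :: real)"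
      unfolding of_int_le_iff .
    then have two_thirds: "of_int (k - m) \<le> 2 / 3 * l" "of_int (n - k) \<le> 2 / 3 * l"
      by (simp_all add: l_def)
    have l: "0 < l"
      using less.prems by (simp add: l_def)
    have part: "x powr \<theta> \<le> x * (q * l powr (\<theta> - 1))" if "0 < x" "x \<le> 2 / 3 * l" for x
    proof -
      have "x powr \<theta> = x * x powr (\<theta> - 1)"
        using that by (simp add: powr_mult_base)
      also have "x powr (\<theta> - 1) \<le> (2 / 3 * l) powr (\<theta> - 1)"
        using that \<theta> by (intro powr_mono2) auto
      also have "\<dots> = q * l powr (\<theta> - 1)"
        using l by (simp only: powr_mult q_def)
      finally show ?thesis
        using that by (simp add: mult_left_mono)
    qed
    have "of_int (k - m) powr \<theta> + of_int (n - k) powr \<theta>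
        \<le> of_int (k - m) * (q * l powr (\<theta> - 1)) + of_int (n - k) * (q * l powr (\<theta> - 1))"
      using k two_thirds by (intro add_mono part) auto
    also have "\<dots> = q * (l * l powr (\<theta> - 1))"
      by (simp add: l_def algebra_simps)
    also have "l * l powr (\<theta> - 1) = l powr \<theta>"
      using l by (simp add: powr_mult_base)
    finally have halves: "of_int (k - m) powr \<theta> + of_int (n - k) powr \<theta> \<le> q * l powr \<theta>" .
    have "\<bar>R m k\<bar> \<le> A / (1 - q) * of_int (k - m) powr \<theta>"
      unfolding q_def by (rule less.hyps) (use k less.prems in auto)
    moreover have "\<bar>R k n\<bar> \<le> A / (1 - q) * of_int (n - k) powr \<theta>"
      unfolding q_def by (rule less.hyps) (use k less.prems in auto)
    moreover have "\<bar>R m n - R m k - R k n\<bar> \<le> A * l powr \<theta>"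
      unfolding l_def using k less.prems by (intro defect) auto
    ultimately have "\<bar>R m n\<bar> \<le> A / (1 - q) * (of_int (k - m) powr \<theta> + of_int (n - k) powr \<theta>) + A * l powr \<theta>"
      by (simp add: distrib_left)
    also have "\<dots> \<le> A / (1 - q) * (q * l powr \<theta>) + A * l powr \<theta>"
      using A q by (intro add_right_mono mult_left_mono halves) auto
    also have "\<dots> = A / (1 - q) * l powr \<theta>"
      using q by (simp add: field_simps)
    finally show ?thesis
      by (simp add: q_def l_def)
  qed
qed

section \<open>Hoelder constants on a grid\<close>

text \<open>
  Hoelder continuity along the grid points \<open>i * h\<close>. Grid functions are indexed by integers because the
  history of a delay equation lives at negative indices.
\<close>

definition grid_holder :: "real \<Rightarrow> real \<Rightarrow> (int \<Rightarrow> real) \<Rightarrow> int \<Rightarrow> int \<Rightarrow> real \<Rightarrow> bool" where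
  "grid_holder h \<beta> x a e P \<longleftrightarrow>
     (\<forall>i j. a \<le> i \<longrightarrow> i < j \<longrightarrow> j \<le> e \<longrightarrow> \<bar>x j - x i\<bar> \<le> P * (of_int (j - i) * h) powr \<beta>)"

lemma grid_holderD:
  "grid_holder h \<beta> x a e P \<Longrightarrow> a \<le> i \<Longrightarrow> i < j \<Longrightarrow> j \<le> e \<Longrightarrow>
    \<bar>x j - x i\<bar> \<le> P * (of_int (j - i) * h) powr \<beta>"
  by (auto simp: grid_holder_def)

lemma grid_holder_mono:
  assumes "grid_holder h \<beta> x a e P" "a \<le> a'" "e' \<le> e" "P \<le> P'"
  shows "grid_holder h \<beta> x a' e' P'"
  unfolding grid_holder_def
proof (intro allI impI)
  fix i j assume "a' \<le> i" "i < j" "j \<le> e'"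
  then have "\<bar>x j - x i\<bar> \<le> P * (of_int (j - i) * h) powr \<beta>"
    using assms by (intro grid_holderD[OF assms(1)]) auto
  also have "\<dots> \<le> P' * (of_int (j - i) * h) powr \<beta>"
    using assms by (intro mult_right_mono) auto
  finally show "\<bar>x j - x i\<bar> \<le> P' * (of_int (j - i) * h) powr \<beta>" .
qed

text \<open>
  Adding the constants, rather than taking a sharper combination, is enough here: an increment across \<open>c\<close> splits at \<open>c\<close>, and
  both parts are shorter than the whole.
\<close>

lemma grid_holder_join:
  assumes left: "grid_holder h \<beta> x a c P" and right: "grid_holder h \<beta> x c e Q"
    and h: "0 < h" and \<beta>: "0 \<le> \<beta>" and PQ: "0 \<le> P" "0 \<le> Q"
  shows "grid_holder h \<beta> x a e (P + Q)"
  unfolding grid_holder_def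
proof (intro allI impI)
  fix i j assume ij: "a \<le> i" "i < j" "j \<le> e"
  define p where "p = (of_int (j - i) * h) powr \<beta>"
  have le: "(of_int (j' - i') * h) powr \<beta> \<le> p" if "i \<le> i'" "i' \<le> j'" "j' \<le> j" for i' j'
    unfolding p_def using that h \<beta> by (intro powr_mono2 mult_right_mono) auto
  have L: "\<bar>x j' - x i\<bar> \<le> P * p" if "i \<le> j'" "j' \<le> c" "j' \<le> j" for j'
  proof (cases "j' = i")
    case True
    then show ?thesis using PQ by (simp add: p_def)
  next
    case False
    with that have "\<bar>x j' - x i\<bar> \<le> P * (of_int (j' - i) * h) powr \<beta>"
      using ij by (intro grid_holderD[OF left]) auto
    then show ?thesis
      using mult_left_mono[OF le[of i j'] PQ(1)] that by linarith
  qed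
  have R: "\<bar>x j - x i'\<bar> \<le> Q * p" if "i' \<le> j" "c \<le> i'" "i \<le> i'" for i'
  proof (cases "j = i'")
    case True
    then show ?thesis using PQ by (simp add: p_def)
  next
    case False
    with that have "\<bar>x j - x i'\<bar> \<le> Q * (of_int (j - i') * h) powr \<beta>"
      using ij by (intro grid_holderD[OF right]) auto
    then show ?thesis
      using mult_left_mono[OF le[of i' j] PQ(2)] that by linarith
  qed
  have nonneg: "0 \<le> P * p" "0 \<le> Q * p"
    using PQ by (auto simp: p_def)
  have "\<bar>x j - x i\<bar> \<le> P * p + Q * p"
  proof (cases "j \<le> c \<or> c \<le> i")
    case True
    then show ?thesis
      using L[of j] R[of i] ij nonneg by force
  next
    case False
    then show ?thesis
      using L[of c] R[of c] ij by force
  qed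
  then show "\<bar>x j - x i\<bar> \<le> (P + Q) * (of_int (j - i) * h) powr \<beta>"
    by (simp add: p_def distrib_right)
qed

text \<open>
  On finitely many grid points there is a least Hoelder constant. The absorption argument in
  \<open>window_bound\<close> needs it: the estimate proved there bounds this constant by an expression containing it.
\<close>

lemma grid_holder_exact:
  assumes h: "0 < h"
  obtains Q where "0 \<le> Q" "grid_holder h \<beta> x a e Q"
    "\<And>Q'. 0 \<le> Q' \<Longrightarrow> grid_holder h \<beta> x a e Q' \<Longrightarrow> Q \<le> Q'"
proof -
  define S where "S = (\<lambda>(i, j). \<bar>x j - x i\<bar> / (of_int (j - i) * h) powr \<beta>) ` {(i, j). a \<le> i \<and> i < j \<and> j \<le> e}"
  have "{(i, j). a \<le> i \<and> i < j \<and> j \<le> e} \<subseteq> {a..e} \<times> {a..e}"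
    by auto
  then have fin: "finite (insert 0 S)"
    unfolding S_def by (simp add: finite_subset[OF _ finite_cartesian_product])
  show thesis
  proof (rule that[of "Max (insert 0 S)"])
    show "0 \<le> Max (insert 0 S)"
      using fin by simp
    show "grid_holder h \<beta> x a e (Max (insert 0 S))"
      unfolding grid_holder_def
    proof (intro allI impI)
      fix i j assume ij: "a \<le> i" "i < j" "j \<le> e"
      have "\<bar>x j - x i\<bar> / (of_int (j - i) * h) powr \<beta> \<le> Max (insert 0 S)"
        by (intro Max_ge fin) (use ij in \<open>auto simp: S_def\<close>)
      then show "\<bar>x j - x i\<bar> \<le> Max (insert 0 S) * (of_int (j - i) * h) powr \<beta>"
        using ij h by (simp add: pos_divide_le_eq)
    qed
    fix Q' assume Q': "0 \<le> Q'" "grid_holder h \<beta> x a e Q'"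
    have "s \<le> Q'" if "s \<in> insert 0 S" for s
      using that Q' h unfolding S_def by (auto simp: pos_divide_le_eq dest!: grid_holderD)
    then show "Max (insert 0 S) \<le> Q'"
      using fin by simp
  qed
qed

section \<open>Recursions driven by a Hoelder path\<close>

definition sewing_const :: "real \<Rightarrow> real" where
  "sewing_const \<theta> = 1 / (1 - (2 / 3) powr (\<theta> - 1))"

lemma sewing_const_pos: "1 < \<theta> \<Longrightarrow> 0 < sewing_const \<theta>"
  using powr_less_mono2[of "\<theta> - 1" "2 / 3" 1] by (simp add: sewing_const_def)

text \<open>
  What the window estimate uses about the scheme: \<open>x\<close> is driven step by step by time and by the noise \<open>w\<close>, both
  \<open>\<beta>\<close>-Hoelder with constant \<open>G\<close> on the grid, and the coefficient values \<open>f\<close> and \<open>g\<close> are controlled by the Hoelder constant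
  \<open>P\<close> of \<open>x\<close> on the whole past \<open>{-N..a}\<close>. That they may depend on all of the past is what admits the delay.
\<close>

locale rough_recursion =
  fixes h \<beta> G c1 c2 :: real and x w f g :: "int \<Rightarrow> real" and N :: int
  assumes h: "0 < h" and \<beta>: "1 / 2 < \<beta>" and G: "0 \<le> G" and c1: "0 \<le> c1" and c2: "0 \<le> c2"
    and recursion: "\<And>i. 0 \<le> i \<Longrightarrow> i < N \<Longrightarrow> x (i + 1) = x i + f i * h + g i * (w (i + 1) - w i)"
    and drift: "grid_holder h \<beta> (\<lambda>i. of_int i * h) 0 N G"
    and noise: "grid_holder h \<beta> w 0 N G"
    and growth: "\<And>a P. 0 \<le> a \<Longrightarrow> a < N \<Longrightarrow> 0 \<le> P \<Longrightarrow> grid_holder h \<beta> x (-N) a P \<Longrightarrow>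
      \<bar>f a\<bar> + \<bar>g a\<bar> \<le> c1 * (1 + P)"
    and regularity: "\<And>a e P m k. 0 \<le> m \<Longrightarrow> m < k \<Longrightarrow> k \<le> e \<Longrightarrow> e < N \<Longrightarrow> 0 \<le> P \<Longrightarrow>
      grid_holder h \<beta> x (-N) e P \<Longrightarrow>
      \<bar>f k - f m\<bar> + \<bar>g k - g m\<bar> \<le> c2 * (1 + P) * (of_int (k - m) * h) powr \<beta>"
begin

abbreviation "\<kappa> \<equiv> sewing_const (2 * \<beta>)"

lemma driver_bound:
  assumes "0 \<le> m" "m < n" "n \<le> N"
  shows "\<bar>u * (of_int (n - m) * h) + v * (w n - w m)\<bar> \<le> (\<bar>u\<bar> + \<bar>v\<bar>) * (G * (of_int (n - m) * h) powr \<beta>)"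
proof -
  have "\<bar>of_int (n - m) * h\<bar> \<le> G * (of_int (n - m) * h) powr \<beta>"
    using grid_holderD[OF drift assms] by (simp add: algebra_simps)
  moreover have "\<bar>w n - w m\<bar> \<le> G * (of_int (n - m) * h) powr \<beta>"
    using grid_holderD[OF noise assms] .
  ultimately show ?thesis
    unfolding distrib_right
    by (intro order_trans[OF abs_triangle_ineq] add_mono) (auto simp only: abs_mult intro: mult_left_mono)
qed

text \<open>
  Sewing applied to the error of freezing the coefficients at the left end point. Its defect at \<open>k\<close> is the change of
  the coefficients over \<open>{m..k}\<close> times the driver over \<open>{k..n}\<close>, a product of two factors of order \<open>\<beta>\<close>.
\<close>

lemma remainder_bound:
  assumes "0 \<le> m" "m < n" "n \<le> e" "e \<le> N" and P: "0 \<le> P" "grid_holder h \<beta> x (-N) e P"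
  shows "\<bar>x n - x m - (f m * (of_int (n - m) * h) + g m * (w n - w m))\<bar>
    \<le> \<kappa> * G * c2 * (1 + P) * (of_int (n - m) * h) powr (2 * \<beta>)"
proof -
  define R where "R = (\<lambda>m n. x n - x m - (f m * (of_int (n - m) * h) + g m * (w n - w m)))"
  define A where "A = G * c2 * (1 + P) * h powr (2 * \<beta>)"
  have "\<bar>R m n\<bar> \<le> A / (1 - (2 / 3) powr (2 * \<beta> - 1)) * of_int (n - m) powr (2 * \<beta>)"
  proof (rule discrete_sewing[where a = 0 and e = e])
    show "1 < 2 * \<beta>" "0 \<le> A"
      using \<beta> G c2 P by (auto simp: A_def)
    show "R m (m + 1) = 0" if "0 \<le> m" "m < e" for m
      using recursion[of m] that assms by (simp add: R_def)
    show "\<bar>R m n - R m k - R k n\<bar> \<le> A * of_int (n - m) powr (2 * \<beta>)"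
      if "0 \<le> m" "m < k" "k < n" "n \<le> e" for m k n
    proof -
      define p where "p = (of_int (n - m) * h) powr \<beta>"
      have le: "(of_int (k - m) * h) powr \<beta> \<le> p" "(of_int (n - k) * h) powr \<beta> \<le> p"
        unfolding p_def using that h \<beta> by (auto intro!: powr_mono2 mult_right_mono)
      have "R m n - R m k - R k n = (f k - f m) * (of_int (n - k) * h) + (g k - g m) * (w n - w k)"
        by (simp add: R_def algebra_simps)
      also have "\<bar>\<dots>\<bar> \<le> (\<bar>f k - f m\<bar> + \<bar>g k - g m\<bar>) * (G * (of_int (n - k) * h) powr \<beta>)"
        using that assms by (intro driver_bound) auto
      also have "\<dots> \<le> (c2 * (1 + P) * (of_int (k - m) * h) powr \<beta>) * (G * (of_int (n - k) * h) powr \<beta>)"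
        using that assms G
        by (intro mult_right_mono regularity[of m k k] grid_holder_mono[OF P(2)]) auto
      also have "\<dots> \<le> (c2 * (1 + P) * p) * (G * p)"
        using G c2 P by (intro mult_mono mult_left_mono le) (auto simp: p_def)
      also have "p * p = (of_int (n - m) * h) powr (2 * \<beta>)"
        by (simp add: p_def flip: powr_add)
      then have "p * p = of_int (n - m) powr (2 * \<beta>) * h powr (2 * \<beta>)"
        using that h by (simp add: powr_mult)
      then have "(c2 * (1 + P) * p) * (G * p) = A * of_int (n - m) powr (2 * \<beta>)"
        by (simp add: A_def mult_ac)
      finally show ?thesis .
    qed
  qed (use assms in auto)
  then show ?thesis
    using assms h by (simp add: R_def A_def sewing_const_def powr_mult mult_ac)
qed

text \<open>
  On the window \<open>{a..e}\<close> let \<open>Q\<close> be the least Hoelder constant of \<open>x\<close>, so that \<open>P + Q\<close> is one on the whole past of \<open>e\<close>.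
  The frozen coefficients contribute \<open>G * c1 * (1 + P)\<close> to \<open>Q\<close>; their variation over the window and the remainder contribute
  multiples of \<open>\<tau> powr \<beta> * (1 + P + Q)\<close>, together at most half of \<open>1 + P + Q\<close> by the choice of \<open>\<tau>\<close>.
  Hence \<open>Q\<close> can be absorbed on the left.
\<close>

lemma window_bound:
  assumes a: "0 \<le> a" "a \<le> e" "e \<le> N" and \<tau>: "of_int (e - a) * h \<le> \<tau>"
    and small: "(\<kappa> + 1) * G * c2 * \<tau> powr \<beta> \<le> 1 / 2"
    and P: "0 \<le> P" "grid_holder h \<beta> x (-N) a P"
  shows "grid_holder h \<beta> x (-N) e ((2 * G * c1 + 2) * (1 + P) - 1)"
proof (cases "a = e")
  case True
  have "P \<le> (2 * G * c1 + 2) * (1 + P) - 1"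
    using G c1 P by (simp add: algebra_simps)
  then show ?thesis
    using grid_holder_mono[OF P(2)] True by blast
next
  case False
  with a have "a < e" by simp
  obtain Q where Q: "0 \<le> Q" "grid_holder h \<beta> x a e Q"
    and least: "\<And>Q'. 0 \<le> Q' \<Longrightarrow> grid_holder h \<beta> x a e Q' \<Longrightarrow> Q \<le> Q'"
    using grid_holder_exact[OF h] by metis
  have PQ: "grid_holder h \<beta> x (-N) e (P + Q)"
    using grid_holder_join[OF P(2) Q(2) h _ P(1) Q(1)] \<beta> by simp
  define Q' where "Q' = G * c1 * (1 + P) + (1 + (P + Q)) / 2"
  have "grid_holder h \<beta> x a e Q'"
    unfolding grid_holder_def
  proof (intro allI impI)
    fix m n assume mn: "a \<le> m" "m < n" "n \<le> e"
    define p where "p = (of_int (n - m) * h) powr \<beta>"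
    have p: "0 \<le> p" "p \<le> \<tau> powr \<beta>"
    proof -
      have "of_int (n - m) * h \<le> of_int (e - a) * h"
        using mn h by (intro mult_right_mono) auto
      then show "p \<le> \<tau> powr \<beta>"
        unfolding p_def using mn h \<beta> \<tau> by (intro powr_mono2 order_trans[OF _ \<tau>]) auto
    qed (simp add: p_def)
    have coeff: "\<bar>f m\<bar> + \<bar>g m\<bar> \<le> c1 * (1 + P) + c2 * (1 + (P + Q)) * \<tau> powr \<beta>"
    proof -
      have fa: "\<bar>f a\<bar> + \<bar>g a\<bar> \<le> c1 * (1 + P)"
        using growth[OF a(1) _ P] \<open>a < e\<close> a by simp
      have "\<bar>f m - f a\<bar> + \<bar>g m - g a\<bar> \<le> c2 * (1 + (P + Q)) * \<tau> powr \<beta>"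
      proof (cases "m = a")
        case True
        then show ?thesis using c2 P Q by simp
      next
        case False
        have "\<bar>f m - f a\<bar> + \<bar>g m - g a\<bar> \<le> c2 * (1 + (P + Q)) * (of_int (m - a) * h) powr \<beta>"
          using False mn a P Q by (intro regularity[of a m m] grid_holder_mono[OF PQ]) auto
        also have "\<dots> \<le> c2 * (1 + (P + Q)) * \<tau> powr \<beta>"
        proof (intro mult_left_mono powr_mono2)
          have "of_int (m - a) * h \<le> of_int (e - a) * h"
            using mn h by (intro mult_right_mono) auto
          then show "of_int (m - a) * h \<le> \<tau>"
            using \<tau> by simp
        qed (use mn h \<beta> c2 P Q in auto)
        finally show ?thesis .
      qed
      with fa show ?thesis by linarith
    qed
    have "\<bar>x n - x m - (f m * (of_int (n - m) * h) + g m * (w n - w m))\<bar>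
        \<le> \<kappa> * G * c2 * (1 + (P + Q)) * (of_int (n - m) * h) powr (2 * \<beta>)"
      using mn a P Q by (intro remainder_bound[OF _ _ _ _ _ PQ]) auto
    moreover have "(of_int (n - m) * h) powr (2 * \<beta>) = p * p"
      using mn by (simp add: p_def flip: powr_add)
    moreover have "\<bar>f m * (of_int (n - m) * h) + g m * (w n - w m)\<bar> \<le> (\<bar>f m\<bar> + \<bar>g m\<bar>) * (G * p)"
      unfolding p_def using mn a by (intro driver_bound) auto
    ultimately have "\<bar>x n - x m\<bar> \<le> (\<bar>f m\<bar> + \<bar>g m\<bar>) * (G * p) + \<kappa> * G * c2 * (1 + (P + Q)) * (p * p)"
      by simp
    also have "\<dots> \<le> (c1 * (1 + P) + c2 * (1 + (P + Q)) * \<tau> powr \<beta>) * (G * p)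
        + \<kappa> * G * c2 * (1 + (P + Q)) * (\<tau> powr \<beta> * p)"
      using p G c2 P Q sewing_const_pos[of "2 * \<beta>"] \<beta> by (intro add_mono mult_right_mono mult_left_mono coeff) auto
    also have "\<dots> = (G * c1 * (1 + P) + ((\<kappa> + 1) * G * c2 * \<tau> powr \<beta>) * (1 + (P + Q))) * p"
      by (simp add: algebra_simps)
    also have "\<dots> \<le> (G * c1 * (1 + P) + 1 / 2 * (1 + (P + Q))) * p"
      using p P Q by (intro mult_right_mono add_left_mono small) auto
    finally show "\<bar>x n - x m\<bar> \<le> Q' * (of_int (n - m) * h) powr \<beta>"
      by (simp add: Q'_def p_def)
  qed
  moreover have "0 \<le> Q'"
    using G c1 P Q by (simp add: Q'_def)
  ultimately have "Q \<le> Q'"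
    by (rule least[rotated])
  then have "P + Q \<le> (2 * G * c1 + 2) * (1 + P) - 1"
    by (simp add: Q'_def field_simps)
  then show ?thesis
    using grid_holder_mono[OF PQ] by blast
qed

text \<open>
  The number \<open>J\<close> of windows of \<open>l\<close> steps depends on \<open>\<tau>\<close> but not on the mesh, as long as \<open>l * h\<close> is comparable with \<open>\<tau>\<close>.
\<close>

lemma global_bound:
  assumes l: "1 \<le> l" "of_int l * h \<le> \<tau>" and J: "N \<le> int J * l" and N: "0 \<le> N"
    and small: "(\<kappa> + 1) * G * c2 * \<tau> powr \<beta> \<le> 1 / 2"
    and P: "0 \<le> P" "grid_holder h \<beta> x (-N) 0 P"
  shows "grid_holder h \<beta> x (-N) N ((2 * G * c1 + 2) ^ J * (1 + P) - 1)"
proof -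
  define \<Lambda> where "\<Lambda> = 2 * G * c1 + 2"
  have \<Lambda>: "1 \<le> \<Lambda>"
    using G c1 by (simp add: \<Lambda>_def)
  have "grid_holder h \<beta> x (-N) (min N (int j * l)) (\<Lambda> ^ j * (1 + P) - 1)" for j
  proof (induction j)
    case 0
    show ?case
      using P(2) N by simp
  next
    case (Suc j)
    define a where "a = min N (int j * l)"
    define e where "e = min N (int (Suc j) * l)"
    have ae: "0 \<le> a" "a \<le> e" "e \<le> N" "e - a \<le> l"
      using N l by (auto simp: a_def e_def algebra_simps min_def)
    have "of_int (e - a) * h \<le> of_int l * h"
      using ae h by (intro mult_right_mono) (auto simp flip: of_int_diff)
    then have "of_int (e - a) * h \<le> \<tau>"
      using l by linarith
    moreover have "1 * 1 \<le> \<Lambda> ^ j * (1 + P)"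
      using \<Lambda> P by (intro mult_mono) auto
    ultimately show ?case
      using window_bound[OF ae(1-3) _ small _ Suc.IH[folded a_def]]
      by (simp add: e_def \<Lambda>_def mult_ac)
  qed
  from this[of J] show ?thesis
    using J by (simp add: \<Lambda>_def min_absorb1)
qed

end

section \<open>The Euler scheme along a single path\<close>

locale delay_coefficients =
  fixes T \<beta> L0 L1 L2 L3 K1 K2 K3 :: real
    and b \<sigma> K :: "real \<Rightarrow> real \<Rightarrow> real \<Rightarrow> real" and \<phi> :: "real \<Rightarrow> real"
  assumes T: "0 < T" and \<beta>: "1 / 2 < \<beta>" "\<beta> < 1"
    and nonneg: "0 \<le> L0" "0 \<le> L1" "0 \<le> L2" "0 \<le> L3" "0 \<le> K1" "0 \<le> K2" "0 \<le> K3"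
    and initial: "\<And>s t. s \<in> {-T..0} \<Longrightarrow> t \<in> {-T..0} \<Longrightarrow> \<bar>\<phi> t - \<phi> s\<bar> \<le> L0 * \<bar>t - s\<bar> powr \<beta>"
    and coeff_time: "\<And>s t x y. s \<in> {0..T} \<Longrightarrow> t \<in> {0..T} \<Longrightarrow>
      \<bar>b t x y - b s x y\<bar> + \<bar>\<sigma> t x y - \<sigma> s x y\<bar> \<le> L1 * \<bar>t - s\<bar>"
    and coeff_space: "\<And>t x1 x2 y1 y2. t \<in> {0..T} \<Longrightarrow>
      \<bar>b t x1 y1 - b t x2 y2\<bar> + \<bar>\<sigma> t x1 y1 - \<sigma> t x2 y2\<bar> \<le> L2 * (\<bar>x1 - x2\<bar> + \<bar>y1 - y2\<bar>)"
    and coeff_growth: "\<And>t x y. t \<in> {0..T} \<Longrightarrow> \<bar>b t x y\<bar> + \<bar>\<sigma> t x y\<bar> \<le> L3 * (1 + \<bar>x\<bar> + \<bar>y\<bar>)"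
    and kernel_time: "\<And>t u s v x. t \<in> {0..T} \<Longrightarrow> u \<in> {0..T} \<Longrightarrow> s \<in> {-T..0} \<Longrightarrow> v \<in> {-T..0} \<Longrightarrow>
      \<bar>K t s x - K u v x\<bar> \<le> K1 * (\<bar>t - u\<bar> + \<bar>s - v\<bar>)"
    and kernel_space: "\<And>t s x y. t \<in> {0..T} \<Longrightarrow> s \<in> {-T..0} \<Longrightarrow> \<bar>K t s x - K t s y\<bar> \<le> K2 * \<bar>x - y\<bar>"
    and kernel_growth: "\<And>t s x. t \<in> {0..T} \<Longrightarrow> s \<in> {-T..0} \<Longrightarrow> \<bar>K t s x\<bar> \<le> K3 * (1 + \<bar>x\<bar>)"
begin

text \<open>
  \<open>S\<close> converts time increments into powers: a length \<open>u \<le> T\<close> is at most \<open>S * u powr \<beta>\<close>. The constants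
  \<open>c1\<close> and \<open>c2\<close> are those of the growth and regularity conditions of \<open>rough_recursion\<close>; they are
  fixed before the driving path and the mesh.
\<close>

definition S :: real where "S = T powr (1 - \<beta>)"

definition c1 :: real where "c1 = L3 * (1 + T * K3) * (1 + \<bar>\<phi> 0\<bar> + T powr \<beta>)"

definition c2 :: real where "c2 = L1 * S + L2 * (1 + T * K1 * S + T * K2)"

lemma S_nonneg: "0 \<le> S"
  by (simp add: S_def)

lemma c1_nonneg: "0 \<le> c1"
  using T nonneg by (simp add: c1_def)

lemma c2_nonneg: "0 \<le> c2"
  using T nonneg by (simp add: c2_def S_def)

lemma time_le_powr:
  assumes "0 \<le> u" "u \<le> T"
  shows "u \<le> S * u powr \<beta>"
proof (cases "u = 0")
  case False
  then have "u = u powr (1 - \<beta>) * u powr \<beta>"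
    using assms by (simp flip: powr_add)
  also have "\<dots> \<le> S * u powr \<beta>"
    unfolding S_def using assms \<beta> by (intro mult_right_mono powr_mono2) auto
  finally show ?thesis .
qed simp

end

locale holder_driven_euler = delay_coefficients +
  fixes w :: "real \<Rightarrow> real" and G :: real and N :: nat
  assumes N: "1 \<le> N" and G: "S \<le> G"
    and driver: "\<And>s t. s \<in> {0..T} \<Longrightarrow> t \<in> {0..T} \<Longrightarrow> \<bar>w t - w s\<bar> \<le> G * \<bar>t - s\<bar> powr \<beta>"
begin

definition h :: real where "h = T / real N"

abbreviation X :: "real \<Rightarrow> real" where "X \<equiv> euler_path b \<sigma> K \<phi> T N w"

abbreviation x :: "int \<Rightarrow> real" where "x i \<equiv> X (of_int i * h)"

abbreviation y :: "int \<Rightarrow> real" where "y i \<equiv> euler_Y K T N X (of_int i * h)"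

abbreviation f :: "int \<Rightarrow> real" where "f i \<equiv> b (of_int i * h) (x i) (y i)"

abbreviation g :: "int \<Rightarrow> real" where "g i \<equiv> \<sigma> (of_int i * h) (x i) (y i)"

lemma h_pos: "0 < h"
  using T N by (simp add: h_def)

lemma N_h: "real N * h = T"
  using N by (simp add: h_def)

lemma G_nonneg: "0 \<le> G"
  using G S_nonneg by simp

text \<open>
  Grid indices are integers, whereas the number of steps and the indices in \<open>euler_step\<close> are natural numbers; the following
  comparisons translate between them.
\<close>

lemma grid_le:
  assumes "i \<le> int j"
  shows "of_int i * h \<le> real j * h"
proof -
  have "(of_int i :: real) \<le> of_int (int j)"
    using assms unfolding of_int_le_iff .
  then show ?thesis
    using h_pos by simp
qed

lemma grid_ge:
  assumes "- int j \<le> i"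
  shows "- (real j * h) \<le> of_int i * h"
  using grid_le[of "- i" j] assms by simp

lemma grid_in: "0 \<le> i \<Longrightarrow> i \<le> int N \<Longrightarrow> of_int i * h \<in> {0..T}"
  using grid_le[of i N] grid_ge[of 0 i] N_h by simp

lemma grid_in_past: "- int N \<le> i \<Longrightarrow> i \<le> 0 \<Longrightarrow> of_int i * h \<in> {-T..0}"
  using grid_le[of i 0] grid_ge[of N i] N_h by simp

text \<open>
  The quadrature nodes \<open>t\<^sub>i\<close> are grid points, so at grid times the delay term reads the scheme at grid points only.
\<close>

lemma delay_grid:
  "y n = (\<Sum>i\<in>{- int N..-1}. h * K (of_int n * h) (of_int i * h) (x (n + i)))"
  unfolding euler_Y_def Let_def h_def[symmetric] of_int_add distrib_right ..

lemma sum_weights: "(\<Sum>i\<in>{- int N..-1}. h * c) = T * c"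
  using N_h by (simp add: mult.assoc[symmetric])

text \<open>
  The scheme starts at \<open>\<phi> 0\<close> and no time is further than \<open>T\<close> from \<open>0\<close>, so a Hoelder constant already bounds
  the values. The later estimates therefore have to follow a single quantity.
\<close>

lemma path_bound:
  assumes "- int N \<le> i" "i \<le> a" "0 \<le> a" "a \<le> int N" and P: "0 \<le> P" "grid_holder h \<beta> x (- int N) a P"
  shows "\<bar>x i\<bar> \<le> \<bar>\<phi> 0\<bar> + P * T powr \<beta>"
proof -
  have x0: "x 0 = \<phi> 0"
    using euler_initial[OF T, of 0] by simp
  have le: "P * (of_int j * h) powr \<beta> \<le> P * T powr \<beta>" if "0 \<le> j" "j \<le> int N" for j
    using grid_in[OF that] P \<beta> by (intro mult_left_mono powr_mono2) auto
  consider "i = 0" | "i < 0" | "0 < i" by linarith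
  then have "\<bar>x i - x 0\<bar> \<le> P * T powr \<beta>"
  proof cases
    case 1
    then show ?thesis using P by simp
  next
    case 2
    then have "\<bar>x 0 - x i\<bar> \<le> P * (of_int (0 - i) * h) powr \<beta>"
      using assms by (intro grid_holderD[OF P(2)]) auto
    also have "\<dots> \<le> P * T powr \<beta>"
      using 2 assms by (intro le) auto
    finally show ?thesis
      by (simp add: abs_minus_commute)
  next
    case 3
    then have "\<bar>x i - x 0\<bar> \<le> P * (of_int (i - 0) * h) powr \<beta>"
      using assms by (intro grid_holderD[OF P(2)]) auto
    also have "\<dots> \<le> P * T powr \<beta>"
      using 3 assms by (intro le) auto
    finally show ?thesis .
  qed
  then show ?thesis
    unfolding x0 by linarith
qed

lemma delay_bound:
  assumes "0 \<le> a" "a \<le> int N" and P: "0 \<le> P" "grid_holder h \<beta> x (- int N) a P"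
  shows "\<bar>y a\<bar> \<le> T * (K3 * (1 + (\<bar>\<phi> 0\<bar> + P * T powr \<beta>)))"
proof -
  have "\<bar>y a\<bar> \<le> (\<Sum>i\<in>{- int N..-1}. \<bar>h * K (of_int a * h) (of_int i * h) (x (a + i))\<bar>)"
    unfolding delay_grid by (rule sum_abs)
  also have "\<dots> \<le> (\<Sum>i\<in>{- int N..-1}. h * (K3 * (1 + (\<bar>\<phi> 0\<bar> + P * T powr \<beta>))))"
  proof (rule sum_mono)
    fix i assume i: "i \<in> {- int N..-1}"
    have "\<bar>K (of_int a * h) (of_int i * h) (x (a + i))\<bar> \<le> K3 * (1 + \<bar>x (a + i)\<bar>)"
      using i assms by (intro kernel_growth grid_in grid_in_past) auto
    also have "\<dots> \<le> K3 * (1 + (\<bar>\<phi> 0\<bar> + P * T powr \<beta>))"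
      using i assms nonneg by (intro mult_left_mono add_left_mono path_bound[where a = a]) auto
    finally show "\<bar>h * K (of_int a * h) (of_int i * h) (x (a + i))\<bar>
        \<le> h * (K3 * (1 + (\<bar>\<phi> 0\<bar> + P * T powr \<beta>)))"
      using h_pos by (simp add: abs_mult)
  qed
  also have "\<dots> = T * (K3 * (1 + (\<bar>\<phi> 0\<bar> + P * T powr \<beta>)))"
    by (rule sum_weights)
  finally show ?thesis .
qed

text \<open>
  Both indices of the compared values are shifted by the same \<open>i < 0\<close>, so their distance is unchanged and they stay in the range
  where the Hoelder constant \<open>P\<close> is known.
\<close>

lemma delay_holder:
  assumes "0 \<le> m" "m < k" "k \<le> a" "a \<le> int N" and P: "0 \<le> P" "grid_holder h \<beta> x (- int N) a P"
  shows "\<bar>y k - y m\<bar> \<le> T * (K1 * S + K2 * P) * (of_int (k - m) * h) powr \<beta>"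
proof -
  define p where "p = (of_int (k - m) * h) powr \<beta>"
  have step: "of_int (k - m) * h \<le> S * p"
    unfolding p_def using grid_in[of "k - m"] assms by (intro time_le_powr) auto
  have "\<bar>y k - y m\<bar> \<le> (\<Sum>i\<in>{- int N..-1}.
      \<bar>h * K (of_int k * h) (of_int i * h) (x (k + i)) - h * K (of_int m * h) (of_int i * h) (x (m + i))\<bar>)"
    unfolding delay_grid sum_subtractf[symmetric] by (rule sum_abs)
  also have "\<dots> \<le> (\<Sum>i\<in>{- int N..-1}. h * ((K1 * S + K2 * P) * p))"
  proof (rule sum_mono)
    fix i assume i: "i \<in> {- int N..-1}"
    let ?K = "\<lambda>j. K (of_int j * h) (of_int i * h)"
    have "\<bar>?K k (x (k + i)) - ?K m (x (k + i))\<bar> \<le> K1 * (\<bar>of_int k * h - of_int m * h\<bar> + \<bar>of_int i * h - of_int i * h\<bar>)"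
      using i assms by (intro kernel_time grid_in grid_in_past) auto
    also have "\<dots> = K1 * (of_int (k - m) * h)"
      using assms h_pos by (simp add: left_diff_distrib[symmetric])
    also have "\<dots> \<le> K1 * (S * p)"
      using nonneg by (intro mult_left_mono step) auto
    finally have 1: "\<bar>?K k (x (k + i)) - ?K m (x (k + i))\<bar> \<le> K1 * (S * p)" .
    have "\<bar>?K m (x (k + i)) - ?K m (x (m + i))\<bar> \<le> K2 * \<bar>x (k + i) - x (m + i)\<bar>"
      using i assms by (intro kernel_space grid_in grid_in_past) auto
    also have "\<dots> \<le> K2 * (P * p)"
      using grid_holderD[OF P(2), of "m + i" "k + i"] i assms nonneg
      by (intro mult_left_mono) (auto simp: p_def)
    finally have 2: "\<bar>?K m (x (k + i)) - ?K m (x (m + i))\<bar> \<le> K2 * (P * p)" .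
    have "\<bar>?K k (x (k + i)) - ?K m (x (m + i))\<bar> \<le> (K1 * S + K2 * P) * p"
      using 1 2 by (simp add: algebra_simps)
    then show "\<bar>h * ?K k (x (k + i)) - h * ?K m (x (m + i))\<bar> \<le> h * ((K1 * S + K2 * P) * p)"
      using h_pos by (simp add: abs_mult right_diff_distrib[symmetric])
  qed
  also have "\<dots> = T * ((K1 * S + K2 * P) * p)"
    by (rule sum_weights)
  finally show ?thesis
    by (simp add: p_def mult.assoc)
qed

lemma coefficient_growth:
  assumes "0 \<le> a" "a \<le> int N" and P: "0 \<le> P" "grid_holder h \<beta> x (- int N) a P"
  shows "\<bar>f a\<bar> + \<bar>g a\<bar> \<le> c1 * (1 + P)"
proof -
  define u where "u = \<bar>\<phi> 0\<bar> + P * T powr \<beta>"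
  have "\<bar>f a\<bar> + \<bar>g a\<bar> \<le> L3 * (1 + \<bar>x a\<bar> + \<bar>y a\<bar>)"
    using assms by (intro coeff_growth grid_in) auto
  also have "\<dots> \<le> L3 * (1 + u + T * (K3 * (1 + u)))"
    unfolding u_def using assms nonneg
    by (intro mult_left_mono add_mono path_bound[where a = a] delay_bound) auto
  also have "\<dots> = L3 * (1 + T * K3) * (1 + u)"
    by (simp add: algebra_simps)
  also have "\<dots> \<le> L3 * (1 + T * K3) * ((1 + \<bar>\<phi> 0\<bar> + T powr \<beta>) * (1 + P))"
  proof (rule mult_left_mono)
    show "1 + u \<le> (1 + \<bar>\<phi> 0\<bar> + T powr \<beta>) * (1 + P)"
      using P by (simp add: u_def algebra_simps)
  qed (use T nonneg in auto)
  finally show ?thesis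
    by (simp add: c1_def mult.assoc)
qed

lemma coefficient_holder:
  assumes mk: "0 \<le> m" "m < k" "k \<le> e" "e \<le> int N" and P: "0 \<le> P" "grid_holder h \<beta> x (- int N) e P"
  shows "\<bar>f k - f m\<bar> + \<bar>g k - g m\<bar> \<le> c2 * (1 + P) * (of_int (k - m) * h) powr \<beta>"
proof -
  define p where "p = (of_int (k - m) * h) powr \<beta>"
  have in_T: "of_int k * h \<in> {0..T}" "of_int m * h \<in> {0..T}"
    using mk by (auto intro!: grid_in simp del: atLeastAtMost_iff)
  have "of_int (k - m) * h \<le> S * p"
    unfolding p_def using grid_in[of "k - m"] mk by (intro time_le_powr) auto
  moreover have "\<bar>of_int k * h - of_int m * h\<bar> = of_int (k - m) * h"
    using mk h_pos by (simp add: left_diff_distrib[symmetric])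
  ultimately have "L1 * \<bar>of_int k * h - of_int m * h\<bar> \<le> L1 * (S * p)"
    using nonneg by (simp add: mult_left_mono)
  moreover have "L2 * (\<bar>x k - x m\<bar> + \<bar>y k - y m\<bar>) \<le> L2 * (P * p + T * (K1 * S + K2 * P) * p)"
    unfolding p_def using mk P nonneg
    by (intro mult_left_mono add_mono grid_holderD[OF P(2)] delay_holder[where a = e]) auto
  moreover have "\<bar>f k - f m\<bar> + \<bar>g k - g m\<bar>
      \<le> L1 * \<bar>of_int k * h - of_int m * h\<bar> + L2 * (\<bar>x k - x m\<bar> + \<bar>y k - y m\<bar>)"
  proof -
    have split: "\<bar>u - u'\<bar> + \<bar>v - v'\<bar> \<le> B + D"
      if "\<bar>u - u0\<bar> + \<bar>v - v0\<bar> \<le> B" "\<bar>u0 - u'\<bar> + \<bar>v0 - v'\<bar> \<le> D" for u u' u0 v v' v0 B D :: real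
      using that by linarith
    show ?thesis
      by (rule split[OF coeff_time[OF in_T(2,1)] coeff_space[OF in_T(2)]])
  qed
  ultimately have "\<bar>f k - f m\<bar> + \<bar>g k - g m\<bar> \<le> L1 * (S * p) + L2 * (P * p + T * (K1 * S + K2 * P) * p)"
    by (meson add_mono order_trans)
  also have "\<dots> = (L1 * S + L2 * (P + T * K1 * S + T * K2 * P)) * p"
    by (simp add: algebra_simps)
  also have "\<dots> \<le> c2 * (1 + P) * p"
  proof (rule mult_right_mono)
    have "0 \<le> L1 * S * P + L2 * (1 + T * K1 * S * P + T * K2)"
      using nonneg P T S_nonneg by (intro add_nonneg_nonneg mult_nonneg_nonneg) auto
    then show "L1 * S + L2 * (P + T * K1 * S + T * K2 * P) \<le> c2 * (1 + P)"
      by (simp add: c2_def algebra_simps)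
  qed (simp add: p_def)
  finally show ?thesis
    by (simp add: p_def)
qed

text \<open>
  Between two grid points the scheme is an affine combination of time and of the driving path, with frozen coefficients.
\<close>

lemma within_step:
  assumes i: "i < N" and uv: "real i * h \<le> u" "u \<le> v" "v \<le> real (Suc i) * h"
  shows "\<bar>X v - X u\<bar> \<le> (\<bar>f (int i)\<bar> + \<bar>g (int i)\<bar>) * (G * (v - u) powr \<beta>)"
proof -
  have "0 \<le> real i * h" "real (Suc i) * h \<le> T"
    using grid_in[of "int i"] grid_in[of "int (Suc i)"] i by auto
  then have uvT: "u \<in> {0..T}" "v \<in> {0..T}"
    using uv by auto
  have step: "X z = x (int i) + f (int i) * (z - real i * h) + g (int i) * (w z - w (real i * h))"
    if "real i * h \<le> z" "z \<le> real (Suc i) * h" for z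
    using euler_step[OF T i that[unfolded h_def], of b \<sigma> K \<phi> w] by (simp add: h_def)
  have increment: "X v - X u = f (int i) * (v - u) + g (int i) * (w v - w u)"
    using step[of u] step[of v] uv by (simp add: algebra_simps)
  have "\<bar>X v - X u\<bar> \<le> \<bar>f (int i)\<bar> * (v - u) + \<bar>g (int i)\<bar> * \<bar>w v - w u\<bar>"
    unfolding increment using uv by (intro order_trans[OF abs_triangle_ineq]) (simp add: abs_mult)
  also have "\<dots> \<le> \<bar>f (int i)\<bar> * (G * (v - u) powr \<beta>) + \<bar>g (int i)\<bar> * (G * (v - u) powr \<beta>)"
  proof -
    have "0 \<le> v - u" "v - u \<le> T"
      using uvT uv(2) by auto
    then have "v - u \<le> S * (v - u) powr \<beta>"
      by (rule time_le_powr)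
    also have "\<dots> \<le> G * (v - u) powr \<beta>"
      using G by (rule mult_right_mono) simp
    finally have drift: "v - u \<le> G * (v - u) powr \<beta>" .
    have noise: "\<bar>w v - w u\<bar> \<le> G * (v - u) powr \<beta>"
      using driver[OF uvT] \<open>0 \<le> v - u\<close> by simp
    show ?thesis
      by (rule add_mono[OF mult_left_mono[OF drift] mult_left_mono[OF noise]]) simp_all
  qed
  finally show ?thesis
    by (simp add: distrib_right)
qed

lemma grid_recursion:
  assumes "0 \<le> i" "i < int N"
  shows "x (i + 1) = x i + f i * h + g i * (w (of_int (i + 1) * h) - w (of_int i * h))"
proof -
  define n where "n = nat i"
  have i: "of_int i = real n" "of_int (i + 1) = real (Suc n)"
    using assms by (simp_all add: n_def)
  have "n < N" "real n * h \<le> real (Suc n) * h"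
    using assms h_pos by (auto simp: n_def)
  then have "X (real (Suc n) * h) = x (int n) + f (int n) * (real (Suc n) * h - real n * h)
      + g (int n) * (w (real (Suc n) * h) - w (real n * h))"
    using euler_step[OF T, of n N "real (Suc n) * h" b \<sigma> K \<phi> w] by (simp only: h_def of_int_of_nat_eq order_refl)
  moreover have "real (Suc n) * h - real n * h = h"
    by (simp add: algebra_simps)
  ultimately show ?thesis
    unfolding i of_int_of_nat_eq by (simp only:)
qed

lemma time_grid_holder: "grid_holder h \<beta> (\<lambda>i. of_int i * h) 0 (int N) G"
  unfolding grid_holder_def
proof (intro allI impI)
  fix i j :: int
  assume ij: "0 \<le> i" "i < j" "j \<le> int N"
  have "of_int (j - i) * h \<le> S * (of_int (j - i) * h) powr \<beta>"
    using grid_in[of "j - i"] ij by (intro time_le_powr) auto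
  also have "\<dots> \<le> G * (of_int (j - i) * h) powr \<beta>"
    using G by (intro mult_right_mono) auto
  finally show "\<bar>of_int j * h - of_int i * h\<bar> \<le> G * (of_int (j - i) * h) powr \<beta>"
    using ij h_pos by (simp add: left_diff_distrib[symmetric])
qed

lemma driver_grid_holder: "grid_holder h \<beta> (\<lambda>i. w (of_int i * h)) 0 (int N) G"
  unfolding grid_holder_def
proof (intro allI impI)
  fix i j :: int
  assume ij: "0 \<le> i" "i < j" "j \<le> int N"
  have "\<bar>w (of_int j * h) - w (of_int i * h)\<bar> \<le> G * \<bar>of_int j * h - of_int i * h\<bar> powr \<beta>"
    using ij by (intro driver grid_in) auto
  then show "\<bar>w (of_int j * h) - w (of_int i * h)\<bar> \<le> G * (of_int (j - i) * h) powr \<beta>"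
    using ij h_pos by (simp add: left_diff_distrib[symmetric])
qed

sublocale grid: rough_recursion h \<beta> G c1 c2 x "\<lambda>i. w (of_int i * h)" f g "int N"
proof (rule rough_recursion.intro)
  show "x (i + 1) = x i + f i * h + g i * (w (of_int (i + 1) * h) - w (of_int i * h))"
    if "0 \<le> i" "i < int N" for i
    using that by (rule grid_recursion)
  show "\<bar>f a\<bar> + \<bar>g a\<bar> \<le> c1 * (1 + P)"
    if "0 \<le> a" "a < int N" "0 \<le> P" "grid_holder h \<beta> x (- int N) a P" for a P
    by (rule coefficient_growth[OF that(1) less_imp_le[OF that(2)] that(3,4)])
  show "\<bar>f k - f m\<bar> + \<bar>g k - g m\<bar> \<le> c2 * (1 + P) * (of_int (k - m) * h) powr \<beta>"
    if "0 \<le> m" "m < k" "k \<le> e" "e < int N" "0 \<le> P" "grid_holder h \<beta> x (- int N) e P" for m k e P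
    by (rule coefficient_holder[OF that(1-3) less_imp_le[OF that(4)] that(5,6)])
qed (fact h_pos \<beta>(1) G_nonneg c1_nonneg c2_nonneg time_grid_holder driver_grid_holder)+

lemma initial_grid_holder: "grid_holder h \<beta> x (- int N) 0 L0"
  unfolding grid_holder_def
proof (intro allI impI)
  fix i j :: int assume ij: "- int N \<le> i" "i < j" "j \<le> 0"
  then have past: "of_int i * h \<in> {-T..0}" "of_int j * h \<in> {-T..0}"
    by (auto intro!: grid_in_past simp del: atLeastAtMost_iff)
  then have "x i = \<phi> (of_int i * h)" "x j = \<phi> (of_int j * h)"
    using T by (auto intro!: euler_initial)
  then have "\<bar>x j - x i\<bar> \<le> L0 * \<bar>of_int j * h - of_int i * h\<bar> powr \<beta>"
    using initial[OF past] by simp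
  then show "\<bar>x j - x i\<bar> \<le> L0 * (of_int (j - i) * h) powr \<beta>"
    using ij h_pos by (simp add: left_diff_distrib[symmetric])
qed

lemma grid_cell:
  assumes "t \<in> {0..T}"
  obtains i where "i < N" "real i * h \<le> t" "t \<le> real (Suc i) * h"
proof (cases "t = T")
  case True
  have "real (N - 1) * h \<le> T"
    using N_h h_pos by (smt (verit) mult_right_mono diff_le_self of_nat_mono)
  then show ?thesis
    using that[of "N - 1"] N N_h True by simp
next
  case False
  define i where "i = nat \<lfloor>t / h\<rfloor>"
  have quot: "0 \<le> t / h" "t / h < real N"
    using assms False h_pos N_h by (auto simp: pos_divide_less_eq)
  have "real i \<le> t / h" "t / h \<le> real (Suc i)"
    using quot(1) by (simp_all add: i_def) linarith
  moreover from this(1) have "real i < real N"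
    using quot(2) by linarith
  then have "i < N"
    by simp
  ultimately show ?thesis
    using that[of i] h_pos by (simp add: pos_le_divide_eq pos_divide_le_eq)
qed

text \<open>
  Cover \<open>{0..T}\<close> by windows of \<open>l = \<lfloor>\<tau> / h\<rfloor>\<close> steps. Since \<open>h < \<tau>\<close>, rounding loses at most a factor two, which explains the
  \<open>2 * T / \<tau>\<close> windows. For times off the grid, go from \<open>s\<close> to the next grid point, along the grid, and from the
  last grid point to \<open>t\<close>; the factor \<open>3\<close> counts these pieces.
\<close>

lemma euler_holder:
  assumes \<tau>: "h < \<tau>" and small: "(sewing_const (2 * \<beta>) + 1) * G * c2 * \<tau> powr \<beta> \<le> 1 / 2"
    and st: "0 \<le> s" "s < t" "t \<le> T"
  defines "P \<equiv> (2 * G * c1 + 2) ^ nat \<lceil>2 * T / \<tau>\<rceil> * (1 + L0) - 1"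
  shows "\<bar>X t - X s\<bar> \<le> 3 * (G * c1 * (1 + P) + P) * (t - s) powr \<beta>"
proof -
  define l where "l = \<lfloor>\<tau> / h\<rfloor>"
  define J where "J = nat \<lceil>2 * T / \<tau>\<rceil>"
  have "0 < \<tau>"
    using \<tau> h_pos by simp
  have ratio: "1 < \<tau> / h"
    using \<tau> h_pos by simp
  have l: "1 \<le> l" "of_int l * h \<le> \<tau>"
    using ratio h_pos by (auto simp: l_def le_floor_iff simp flip: pos_le_divide_eq)
  have "\<tau> / h \<le> 2 * of_int l"
    using ratio l(1) unfolding l_def by linarith
  have "real N = 2 * T / \<tau> * (\<tau> / h / 2)"
    using \<open>0 < \<tau>\<close> h_pos N_h by (simp add: field_simps)
  also have "\<dots> \<le> real J * of_int l"
    using \<open>0 < \<tau>\<close> h_pos T \<open>\<tau> / h \<le> 2 * of_int l\<close>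
    by (intro mult_mono real_nat_ceiling_ge[of "2 * T / \<tau>", folded J_def]) auto
  finally have J: "int N \<le> int J * l"
    by (metis of_int_le_iff of_int_mult of_int_of_nat_eq)
  have P: "grid_holder h \<beta> x (- int N) (int N) P"
    unfolding P_def J_def[symmetric]
    using grid.global_bound[OF l J _ small nonneg(1) initial_grid_holder] by simp
  have "1 \<le> 2 * G * c1 + 2"
    using G_nonneg c1_nonneg by (simp add: add_increasing)
  then have "1 \<le> (2 * G * c1 + 2) ^ J"
    by (rule one_le_power)
  then have "1 * 1 \<le> (2 * G * c1 + 2) ^ J * (1 + L0)"
    using nonneg by (intro mult_mono) auto
  then have P_nonneg: "0 \<le> P"
    by (simp add: P_def J_def)
  define C where "C = G * c1 * (1 + P) + P"
  have C: "P \<le> C" "G * c1 * (1 + P) \<le> C" "0 \<le> C"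
    using P_nonneg G_nonneg c1_nonneg by (auto simp: C_def)
  have le: "C * (v - u) powr \<beta> \<le> C * (t - s) powr \<beta>" if "s \<le> u" "u \<le> v" "v \<le> t" for u v
    using that \<beta> C by (intro mult_left_mono powr_mono2) auto
  have cell: "\<bar>X v - X u\<bar> \<le> C * (t - s) powr \<beta>"
    if "i < N" "real i * h \<le> u" "u \<le> v" "v \<le> real (Suc i) * h" "s \<le> u" "v \<le> t" for i u v
  proof -
    have "\<bar>X v - X u\<bar> \<le> (\<bar>f (int i)\<bar> + \<bar>g (int i)\<bar>) * (G * (v - u) powr \<beta>)"
      using that by (intro within_step)
    also have "\<dots> \<le> (c1 * (1 + P)) * (G * (v - u) powr \<beta>)"
      using that G_nonneg P_nonneg
      by (intro mult_right_mono coefficient_growth grid_holder_mono[OF P]) auto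
    also have "\<dots> = (G * c1 * (1 + P)) * (v - u) powr \<beta>"
      by simp
    also have "\<dots> \<le> C * (v - u) powr \<beta>"
      by (intro mult_right_mono C) auto
    also have "\<dots> \<le> C * (t - s) powr \<beta>"
      using that by (intro le)
    finally show ?thesis .
  qed
  obtain m where m: "m < N" "real m * h \<le> s" "s \<le> real (Suc m) * h"
    using grid_cell[of s] st by auto
  obtain n where n: "n < N" "real n * h \<le> t" "t \<le> real (Suc n) * h"
    using grid_cell[of t] st by auto
  have nonneg': "0 \<le> C * (t - s) powr \<beta>"
    using C by simp
  have "\<bar>X t - X s\<bar> \<le> 3 * (C * (t - s) powr \<beta>)"
  proof (cases "n \<le> m")
    case True
    then have "t \<le> real (Suc m) * h"
      using n grid_le[of "int (Suc n)" "Suc m"] by auto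
    then show ?thesis
      using cell[of m s t] m st nonneg' by linarith
  next
    case False
    then have mn: "real (Suc m) * h \<le> real n * h"
      using grid_le[of "int (Suc m)" n] by simp
    have "\<bar>X (real n * h) - X (real (Suc m) * h)\<bar> \<le> C * (t - s) powr \<beta>"
    proof (cases "n = Suc m")
      case True
      then show ?thesis using nonneg' by simp
    next
      case neq: False
      have "\<bar>x (int n) - x (int (Suc m))\<bar> \<le> P * (of_int (int n - int (Suc m)) * h) powr \<beta>"
        using False neq n by (intro grid_holderD[OF P]) auto
      also have "of_int (int n - int (Suc m)) * h = real n * h - real (Suc m) * h"
        by (simp add: algebra_simps)
      also have "P * (real n * h - real (Suc m) * h) powr \<beta> \<le> C * (real n * h - real (Suc m) * h) powr \<beta>"
        by (intro mult_right_mono C) auto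
      also have "\<dots> \<le> C * (t - s) powr \<beta>"
        using m n mn by (intro le)
      finally show ?thesis by simp
    qed
    moreover have "\<bar>X (real (Suc m) * h) - X s\<bar> \<le> C * (t - s) powr \<beta>"
      using m n mn by (intro cell[of m]) auto
    moreover have "\<bar>X t - X (real n * h)\<bar> \<le> C * (t - s) powr \<beta>"
      using m n mn by (intro cell[of n]) auto
    ultimately show ?thesis
      by linarith
  qed
  then show ?thesis
    unfolding C_def by (simp only: mult.assoc)
qed

end

section \<open>Uniform bounds for the Euler scheme\<close>

theorem theorem2:
  fixes M :: "'a measure" and F :: "real \<Rightarrow> 'a measure" and B :: "real \<Rightarrow> 'a \<Rightarrow> real"
    and r T H L1 L2 L3 K1 K2 K3 \<epsilon> \<rho> :: real
    and b \<sigma> K :: "real \<Rightarrow> real \<Rightarrow> real \<Rightarrow> real"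
    and \<phi> :: "real \<Rightarrow> real"
  assumes "prob_space M" and "usual_conditions M F"
    and "r > 0" and "T = r" and "1 / 2 < H" and "H < 1"
    and "fractional_brownian_motion M H B"
    and "continuous_on ({0..T} \<times> UNIV \<times> UNIV) (\<lambda>(t, x, y). b t x y)"
    and "continuous_on ({0..T} \<times> UNIV \<times> UNIV) (\<lambda>(t, x, y). \<sigma> t x y)"
    and "continuous_on ({0..T} \<times> {-r..0} \<times> UNIV) (\<lambda>(t, s, x). K t s x)"
    and "\<And>\<delta>. 0 < \<delta> \<Longrightarrow> \<delta> < H \<Longrightarrow>
           \<exists>L>0. \<forall>s\<in>{-r..0}. \<forall>t\<in>{-r..0}. \<bar>\<phi> t - \<phi> s\<bar> \<le> L * \<bar>t - s\<bar> powr (H - \<delta>)"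
    and "L1 > 0" and "L2 > 0" and "L3 > 0"
    and "\<And>s t x y. s \<in> {0..T} \<Longrightarrow> t \<in> {0..T} \<Longrightarrow>
           \<bar>b t x y - b s x y\<bar> + \<bar>\<sigma> t x y - \<sigma> s x y\<bar> \<le> L1 * \<bar>t - s\<bar>"
    and "\<And>t x1 x2 y1 y2. t \<in> {0..T} \<Longrightarrow>
           \<bar>b t x1 y1 - b t x2 y2\<bar> + \<bar>\<sigma> t x1 y1 - \<sigma> t x2 y2\<bar> \<le> L2 * (\<bar>x1 - x2\<bar> + \<bar>y1 - y2\<bar>)"
    and "\<And>t x y. t \<in> {0..T} \<Longrightarrow> \<bar>b t x y\<bar> + \<bar>\<sigma> t x y\<bar> \<le> L3 * (1 + \<bar>x\<bar> + \<bar>y\<bar>)"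
    and "\<And>t s x. t \<in> {0..T} \<Longrightarrow> s \<in> {-r..0} \<Longrightarrow> (\<lambda>z. K t s z) differentiable (at x)"
    and "K1 > 0" and "K2 > 0" and "K3 > 0"
    and "\<And>t u s v x. t \<in> {0..T} \<Longrightarrow> u \<in> {0..T} \<Longrightarrow> s \<in> {-r..0} \<Longrightarrow> v \<in> {-r..0} \<Longrightarrow>
           \<bar>K t s x - K u v x\<bar> \<le> K1 * (\<bar>t - u\<bar> + \<bar>s - v\<bar>)"
    and "\<And>t s x y. t \<in> {0..T} \<Longrightarrow> s \<in> {-r..0} \<Longrightarrow> \<bar>K t s x - K t s y\<bar> \<le> K2 * \<bar>x - y\<bar>"
    and "\<And>t s x. t \<in> {0..T} \<Longrightarrow> s \<in> {-r..0} \<Longrightarrow> \<bar>K t s x\<bar> \<le> K3 * (1 + \<bar>x\<bar>)"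
    and "\<epsilon> > 0" and "0 < \<rho>" and "\<rho> < H"
  shows "\<exists>h0>0. \<exists>\<Omega>\<^sub>0\<in>sets M. measure M \<Omega>\<^sub>0 > 1 - \<epsilon> \<and>
           (\<forall>\<omega>\<in>\<Omega>\<^sub>0. \<exists>C>0. \<forall>N::nat. N \<ge> 1 \<longrightarrow> T / real N < h0 \<longrightarrow>
              (\<forall>t\<in>{0..T}. \<bar>euler_path b \<sigma> K \<phi> T N (\<lambda>t. B t \<omega>) t\<bar> < C) \<and>
              (\<forall>s t. 0 \<le> s \<longrightarrow> s < t \<longrightarrow> t \<le> T \<longrightarrow>
                 \<bar>euler_path b \<sigma> K \<phi> T N (\<lambda>t. B t \<omega>) t - euler_path b \<sigma> K \<phi> T N (\<lambda>t. B t \<omega>) s\<bar>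
                   \<le> C * (t - s) powr (H - \<rho>)))"
proof -
  \<comment> \<open>Any exponent in the open interval from \<open>1 / 2\<close> to \<open>H\<close> that is at least \<open>H - \<rho>\<close> would do.\<close>
  define \<beta> where "\<beta> = H - min \<rho> ((H - 1 / 2) / 2)"
  have exponent: "1 / 2 < \<beta>" "\<beta> < H" "H - \<rho> \<le> \<beta>"
    using assms(5) \<open>0 < \<rho>\<close> by (auto simp: \<beta>_def min_def field_simps)
  have T: "0 < T"
    using \<open>r > 0\<close> \<open>T = r\<close> by simp
  obtain L where "0 < L"
    and L: "\<And>s t. s \<in> {-T..0} \<Longrightarrow> t \<in> {-T..0} \<Longrightarrow> \<bar>\<phi> t - \<phi> s\<bar> \<le> L * \<bar>t - s\<bar> powr \<beta>"
    using assms(11)[of "H - \<beta>"] exponent unfolding \<open>T = r\<close> by auto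
  interpret delay_coefficients T \<beta> L L1 L2 L3 K1 K2 K3 b \<sigma> K \<phi>
  proof (rule delay_coefficients.intro)
    show "\<beta> < 1"
      using exponent \<open>H < 1\<close> by simp
  qed (fact T exponent(1) less_imp_le[OF \<open>0 < L\<close>] assms(12-14,19-21)[THEN less_imp_le] L assms(15-17)
      assms(22-24)[folded \<open>T = r\<close>])+
  obtain G0 A where "0 < G0" and A: "A \<in> sets M" "measure M A > 1 - \<epsilon>"
    and G0: "\<And>\<omega> s t. \<omega> \<in> A \<Longrightarrow> s \<in> {0..T} \<Longrightarrow> t \<in> {0..T} \<Longrightarrow>
      \<bar>B t \<omega> - B s \<omega>\<bar> \<le> G0 * \<bar>t - s\<bar> powr \<beta>"
    using fbm_holder_event[OF assms(1) assms(7), of \<beta> T \<epsilon>] exponent T \<open>\<epsilon> > 0\<close> by auto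
  define G where "G = G0 + S"
  have G: "S \<le> G" "0 \<le> G"
    using \<open>0 < G0\<close> S_nonneg by (auto simp: G_def)
  define D where "D = (sewing_const (2 * \<beta>) + 1) * G * c2"
  have D: "0 \<le> D"
    unfolding D_def using sewing_const_pos[of "2 * \<beta>"] exponent G c2_nonneg by simp
  \<comment> \<open>The summand \<open>1\<close> only avoids a division by zero in the case \<open>D = 0\<close>.\<close>
  define \<tau> where "\<tau> = (1 / (2 * (D + 1))) powr (1 / \<beta>)"
  have \<tau>: "0 < \<tau>" "D * \<tau> powr \<beta> \<le> 1 / 2"
    using D exponent by (auto simp: \<tau>_def powr_powr field_simps)
  define P where "P = (2 * G * c1 + 2) ^ nat \<lceil>2 * T / \<tau>\<rceil> * (1 + L) - 1"
  define Q where "Q = 3 * (G * c1 * (1 + P) + P)"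
  \<comment> \<open>The two powers of \<open>T\<close> serve the bound of the values and the passage from the exponent \<open>\<beta>\<close> to \<open>H - \<rho>\<close>.\<close>
  define C where "C = \<bar>\<phi> 0\<bar> + \<bar>Q\<bar> * (T powr \<beta> + T powr (\<beta> - (H - \<rho>))) + 1"
  have "0 < C"
    by (simp add: C_def add_nonneg_pos)
  have "(\<forall>t\<in>{0..T}. \<bar>euler_path b \<sigma> K \<phi> T N (\<lambda>t. B t \<omega>) t\<bar> < C) \<and>
      (\<forall>s t. 0 \<le> s \<longrightarrow> s < t \<longrightarrow> t \<le> T \<longrightarrow>
        \<bar>euler_path b \<sigma> K \<phi> T N (\<lambda>t. B t \<omega>) t - euler_path b \<sigma> K \<phi> T N (\<lambda>t. B t \<omega>) s\<bar>
          \<le> C * (t - s) powr (H - \<rho>))"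
    if \<omega>: "\<omega> \<in> A" and mesh: "1 \<le> N" "T / real N < \<tau>" for \<omega> N
  proof -
    interpret holder_driven_euler T \<beta> L L1 L2 L3 K1 K2 K3 b \<sigma> K \<phi> "\<lambda>t. B t \<omega>" G N
    proof
      show "\<bar>B t \<omega> - B s \<omega>\<bar> \<le> G * \<bar>t - s\<bar> powr \<beta>" if "s \<in> {0..T}" "t \<in> {0..T}" for s t
        using G0[OF \<omega> that] mult_right_mono[of G0 G "\<bar>t - s\<bar> powr \<beta>"] S_nonneg by (simp add: G_def)
    qed (use mesh G in auto)
    have holder: "\<bar>X t - X s\<bar> \<le> \<bar>Q\<bar> * (t - s) powr \<beta>" if "0 \<le> s" "s < t" "t \<le> T" for s t
    proof -
      have "\<bar>X t - X s\<bar> \<le> Q * (t - s) powr \<beta>"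
        using euler_holder[of \<tau> s t] \<tau> mesh that by (simp add: D_def P_def Q_def h_def)
      also have "\<dots> \<le> \<bar>Q\<bar> * (t - s) powr \<beta>"
        by (intro mult_right_mono) auto
      finally show ?thesis .
    qed
    have "\<bar>X t\<bar> < C" if "t \<in> {0..T}" for t
    proof -
      have "\<bar>X t - X 0\<bar> \<le> \<bar>Q\<bar> * T powr \<beta>"
      proof (cases "t = 0")
        case False
        then have "\<bar>X t - X 0\<bar> \<le> \<bar>Q\<bar> * (t - 0) powr \<beta>"
          using that by (intro holder) auto
        also have "\<dots> \<le> \<bar>Q\<bar> * T powr \<beta>"
          using that exponent by (intro mult_left_mono powr_mono2) auto
        finally show ?thesis .
      qed simp
      moreover have "X 0 = \<phi> 0"
        using T by (intro euler_initial) auto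
      moreover have "0 \<le> \<bar>Q\<bar> * T powr (\<beta> - (H - \<rho>))"
        by simp
      ultimately show ?thesis
        unfolding C_def distrib_left by linarith
    qed
    moreover have "\<bar>X t - X s\<bar> \<le> C * (t - s) powr (H - \<rho>)" if "0 \<le> s" "s < t" "t \<le> T" for s t
    proof -
      have "(t - s) powr \<beta> = (t - s) powr (\<beta> - (H - \<rho>)) * (t - s) powr (H - \<rho>)"
        using that by (simp flip: powr_add)
      also have "\<dots> \<le> T powr (\<beta> - (H - \<rho>)) * (t - s) powr (H - \<rho>)"
        using that exponent by (intro mult_right_mono powr_mono2) auto
      finally have "\<bar>Q\<bar> * (t - s) powr \<beta> \<le> \<bar>Q\<bar> * (T powr (\<beta> - (H - \<rho>)) * (t - s) powr (H - \<rho>))"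
        by (rule mult_left_mono) simp
      also have "\<dots> = (\<bar>Q\<bar> * T powr (\<beta> - (H - \<rho>))) * (t - s) powr (H - \<rho>)"
        by simp
      also have "\<dots> \<le> C * (t - s) powr (H - \<rho>)"
        by (intro mult_right_mono) (auto simp: C_def distrib_left)
      finally show ?thesis
        using holder[OF that] by linarith
    qed
    ultimately show ?thesis
      by blast
  qed
  with \<tau>(1) A \<open>0 < C\<close> show ?thesis
    by (intro exI[of _ \<tau>] conjI bexI[of _ A] ballI exI[of _ C]) auto
qed

end
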